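(* Let $\alpha>2$, $\beta>0$, $N_o>0$ and $\gamma\ge 0$ be fixed, and consider the many-to-many communication task described in the context, with propagation model $\eta(d)=\frac{1}{(1+d)^\alpha}$ and the SINR$_\beta$ success criterion. Then there exist constants $c,\overline{c}>0$ depending only on $\alpha,\beta$ such that for every $n$ there is a power $P_n>0$ and for every source-destination set $\mathcal{P}_n$ there is a system $\mathcal{S}_n(\mathcal{P}_n)$ (all transmissions using power $P_n$), with throughput $\lambda_n(\mathcal{P}_n)$, such that for any packet size $W>0$ (bits per slot), as $n\to\infty$, $$\Pr\big(\mathcal{S}_n(\mathcal{P}_n)\text{ is SINR}_\beta\text{-successful at power }P_n\big)\to 1,$$ and - if $\gamma<\tfrac12$: $\Pr\Big(\lambda_n(\mathcal{P}_n)\ge \frac{W}{c\, n^{1-\gamma}}\Big)\to 1$; - if $\gamma\ge\tfrac12$: $\Pr\Big(\lambda_n(\mathcal{P}_n)\ge \frac{W}{\overline{c}\sqrt{n\ln n}}\Big)\to 1$, where probabilities are over the random source-destination set $\mathcal{P}_n$. Moreover, when $\gamma<\tfrac12$, $P_n$ depends on $\alpha,\beta,N_o$ but not on $n$, $\mathcal{P}_n$ or $\gamma$; when $\gamma\ge\tfrac12$, $P_n$ depends on $\alpha,\beta,N_o$, increases with $n$ and $\gamma$, and does not depend on $\mathcal{P}_n$.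
   Context: Network model: $A_n\subset\mathbb{R}^2$ is a disk of radius $n^\gamma$. Nodes $s_1,\dots,s_n$ (identified with their locations) are drawn i.i.d. uniformly on $A_n$; for each $i$, a destination $d_i$ is chosen uniformly from $\{s_j: j\ne i\}$, independently of everything else (two sources may share a destination). The source-destination set is $\mathcal{P}_n=\{(s_1,d_1),\dots,(s_n,d_n)\}$. Time is slotted; every transmitter transmits with the same power $P$ and sends at most one packet of $W$ bits per slot. A route for $(s_i,d_i)$ is a finite sequence of hops $h_{i,j}=(t_{i,j},r_{i,j})$, $j=1,\dots,J_i$, of nodes, with $t_{i,1}=s_i$, $r_{i,j}=t_{i,j+1}$, $r_{i,J_i}=d_i$, and no node repeated. A schedule assigns to each hop a positive integer slot $\sigma_{i,j}$. A system is a set of $n$ scheduled routes, one per pair, that is compatible: no two hops (of the same or different routes) require the same node to transmit in the same slot. Its period is $p=\max_{i,j}\sigma_{i,j}$ and it operates periodically with this period; its throughput is $\lambda=W/p$ bits per slot. For slot $j\in\{1,\dots,p\}$, the hop set $\mathcal{H}_j$ is the set of hops scheduled in slot $j$ and $T_j$ the set of their transmitters. A hop set is successful (under a given criterion) if every hop $(t,r)\in\mathcal{H}_j$ satisfies the criterion with interfering set $T=T_j\setminus\{t\}$; a system is successful if all its hop sets are. SINR$_\beta$ criterion at power $P$ (with noise power $N_o$ and propagation model $\eta$): a transmission from $t$ to $r$ in presence of simultaneous transmitters at the points of a finite set $T$ succeeds iff $$\mathrm{SINR}=\frac{P\eta(\|t-r\|)}{N_o+\sum_{t'\in T}P\eta(\|t'-r\|)}\ge\beta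 .$$ *)

theory Defs
  imports "HOL-Probability.Probability"
begin

text \<open>Nodes are indexed 0..n-1. A configuration (source-destination set) is
  omega :: nat => (real^2 * nat); node i is located at fst (omega i) and its destination
  is the node snd (omega i).\<close>

type_synonym config = "nat \<Rightarrow> ((real^2) \<times> nat)"

definition loc :: "config \<Rightarrow> nat \<Rightarrow> real^2" where
  "loc \<omega> i = fst (\<omega> i)"

definition dest :: "config \<Rightarrow> nat \<Rightarrow> nat" where
  "dest \<omega> i = snd (\<omega> i)"

definition sd_measure :: "real \<Rightarrow> nat \<Rightarrow> config measure" where
  "sd_measure \<gamma> n =
     PiM {..<n} (\<lambda>i. uniform_measure lborel (cball 0 (real n powr \<gamma>))
                     \<Otimes>\<^sub>M uniform_measure (count_space UNIV) ({..<n} - {i}))"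

definition well_formed_sd :: "nat \<Rightarrow> config \<Rightarrow> bool" where
  "well_formed_sd n \<omega> \<longleftrightarrow> (\<forall>i<n. dest \<omega> i < n \<and> dest \<omega> i \<noteq> i)"

definition eta :: "real \<Rightarrow> real \<Rightarrow> real" where
  "eta \<alpha> d = 1 / (1 + d) powr \<alpha>"

text \<open>A system: a route (list of nodes t_1 = s_i, ..., r_J = d_i) per pair and a slot
  sigma i j for hop j of route i.\<close>

type_synonym system = "(nat \<Rightarrow> nat list) \<times> (nat \<Rightarrow> nat \<Rightarrow> nat)"

definition nhops :: "nat list \<Rightarrow> nat" where
  "nhops rt = length rt - 1"

definition valid_route :: "nat \<Rightarrow> config \<Rightarrow> nat \<Rightarrow> nat list \<Rightarrow> bool" where
  "valid_route n \<omega> i rt \<longleftrightarrow>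
     length rt \<ge> 2 \<and> hd rt = i \<and> last rt = dest \<omega> i \<and> distinct rt \<and> set rt \<subseteq> {..<n}"

definition is_system :: "nat \<Rightarrow> config \<Rightarrow> system \<Rightarrow> bool" where
  "is_system n \<omega> S \<longleftrightarrow>
     (\<forall>i<n. valid_route n \<omega> i (fst S i) \<and> (\<forall>j<nhops (fst S i). snd S i j \<ge> 1)) \<and>
     (\<forall>i<n. \<forall>i'<n. \<forall>j<nhops (fst S i). \<forall>j'<nhops (fst S i').
        (i, j) \<noteq> (i', j') \<and> fst S i ! j = fst S i' ! j' \<longrightarrow> snd S i j \<noteq> snd S i' j')"

definition period :: "nat \<Rightarrow> system \<Rightarrow> nat" where
  "period n S = Max {snd S i j | i j. i < n \<and> j < nhops (fst S i)}"

definition throughput :: "real \<Rightarrow> nat \<Rightarrow> system \<Rightarrow> real" where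
  "throughput W n S = W / real (period n S)"

definition hop_set :: "nat \<Rightarrow> system \<Rightarrow> nat \<Rightarrow> (nat \<times> nat) set" where
  "hop_set n S k = {(fst S i ! j, fst S i ! Suc j) | i j.
                      i < n \<and> j < nhops (fst S i) \<and> snd S i j = k}"

definition transmitters :: "nat \<Rightarrow> system \<Rightarrow> nat \<Rightarrow> nat set" where
  "transmitters n S k = fst ` hop_set n S k"

definition SINR_ok ::
  "real \<Rightarrow> real \<Rightarrow> real \<Rightarrow> real \<Rightarrow> real^2 \<Rightarrow> real^2 \<Rightarrow> (real^2) set \<Rightarrow> bool" where
  "SINR_ok \<alpha> \<beta> No P t r T \<longleftrightarrow>
     P * eta \<alpha> (dist t r) / (No + (\<Sum>t'\<in>T. P * eta \<alpha> (dist t' r))) \<ge> \<beta>"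

definition SINR_successful ::
  "real \<Rightarrow> real \<Rightarrow> real \<Rightarrow> real \<Rightarrow> nat \<Rightarrow> config \<Rightarrow> system \<Rightarrow> bool" where
  "SINR_successful \<alpha> \<beta> No P n \<omega> S \<longleftrightarrow>
     (\<forall>k\<in>{1..period n S}. \<forall>(t, r)\<in>hop_set n S k.
        SINR_ok \<alpha> \<beta> No P (loc \<omega> t) (loc \<omega> r)
          (loc \<omega> ` transmitters n S k - {loc \<omega> t}))"

text \<open>Pr(E n) -> 1 (inner probability: some measurable subevents have probability
  tending to 1; equivalent to the usual notion when E n is measurable).\<close>

definition prob_to_one :: "(nat \<Rightarrow> 'a measure) \<Rightarrow> (nat \<Rightarrow> 'a set) \<Rightarrow> bool" where
  "prob_to_one M E \<longleftrightarrow>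
     (\<exists>A. (\<forall>n. A n \<in> sets (M n) \<and> A n \<subseteq> E n) \<and>
          (\<lambda>n. measure (M n) (A n)) \<longlonglongrightarrow> 1)"

end

theory Submission
  imports Defs "HOL-Real_Asymp.Real_Asymp"
begin

text \<open>
  Put a square lattice of mesh s on the disk of radius R = n^gamma, with s = 1 if gamma < 1/2 and
  s = 6 R sqrt (ln n / n) otherwise. With high probability every lattice point of the disk has a
  node within s/3, its relay, and each packet travels along an L-shaped lattice path of relays; one
  of the two possible corners always lies in the disk. A route visits a cell only if its source or
  destination lies in the row or column strip of that cell, so the load of a cell is controlled by
  the number of sources and destinations in strips, and a union bound over Chebyshev estimates shows
  that it is O(n s / R). Cells transmit one packet at a time, and simultaneously only if they are
  congruent modulo a constant M; as alpha > 2, the total interference is then a convergent sum that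
  a large M makes as small as needed, uniformly in s >= 1. The period is thus O(n s / R).
\<close>

subsection \<open>Lattice routes\<close>

text \<open>Write x = R/s. There are O(x^2) lattice points and O(x) strips. A lattice point is left
  without a relay with probability at most exp (-n/(36 x^2)), and a strip is overloaded with
  probability O(x/n). The mesh therefore has to satisfy two demands: n/x^2 must be large enough to
  beat the number of lattice points, and x^2/n must tend to 0. Chebyshev is enough because there are
  only O(x) strips, so their union bound is O(x^2/n); it also copes with the destination locations,
  which are dependent since two sources may draw the same destination. Mesh 1 meets both demands
  exactly while R^2/n tends to 0, that is for gamma < 1/2, and then hops have bounded length and a
  constant power is enough. For gamma >= 1/2 the nodes become too sparse, so the mesh and with it
  the power must grow. The interference bound survives this because signal and interference both
  scale like s^(-alpha), so the reuse constant M does not depend on s. The condition s >= 1 makes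
  the 1 in 1 + d harmless: a hop of length at most 3 s has 1 + d <= 4 s.\<close>

lemma rtrancl_distinct_path:
  assumes "(a, b) \<in> E\<^sup>*"
  shows "\<exists>p. p \<noteq> [] \<and> hd p = a \<and> last p = b \<and> distinct p \<and>
    (\<forall>j. Suc j < length p \<longrightarrow> (p ! j, p ! Suc j) \<in> E)"
  using assms
proof (induction rule: converse_rtrancl_induct)
  case base
  show ?case by (rule exI[of _ "[b]"]) simp
next
  case (step a y)
  then obtain p where p: "p \<noteq> []" "hd p = y" "last p = b" "distinct p"
    "\<And>j. Suc j < length p \<Longrightarrow> (p ! j, p ! Suc j) \<in> E"
    by blast
  show ?case
  proof (cases "a \<in> set p")
    \<comment> \<open>Cutting the loop back to \<open>a\<close> keeps every remaining step an edge.
      This is needed for routes, which may not repeat a node: a source or destination can itself be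
      the relay of a cell on the way.\<close>
    case True
    then obtain us vs where split: "p = us @ a # vs"
      by (auto dest: split_list)
    have "((a # vs) ! j, (a # vs) ! Suc j) \<in> E" if "Suc j < length (a # vs)" for j
      using p(5)[of "length us + j"] that by (simp add: split nth_append)
    then show ?thesis
      using p split by (intro exI[of _ "a # vs"]) auto
  next
    case False
    have "((a # p) ! j, (a # p) ! Suc j) \<in> E" if "Suc j < length (a # p)" for j
      using p that step(1) by (cases j) (auto simp: hd_conv_nth)
    then show ?thesis
      using p False by (intro exI[of _ "a # p"]) auto
  qed
qed

lemma int_segment_rtrancl:
  fixes f :: "int \<Rightarrow> 'a"
  assumes "\<And>p. min a b \<le> p \<Longrightarrow> p < max a b \<Longrightarrow> (f p, f (p + 1)) \<in> E \<and> (f (p + 1), f p) \<in> E"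
  shows "(f a, f b) \<in> E\<^sup>*"
proof (cases "a \<le> b")
  case True
  have "p \<le> b \<Longrightarrow> (f a, f p) \<in> E\<^sup>*" if "a \<le> p" for p
    using that
  proof (induction p rule: int_ge_induct)
    case (step p)
    then show ?case
      using assms[of p] by (auto intro: rtrancl_into_rtrancl)
  qed auto
  then show ?thesis using True by simp
next
  case False
  have "p \<le> a \<Longrightarrow> (f p, f b) \<in> E\<^sup>*" if "b \<le> p" for p
    using that
  proof (induction p rule: int_ge_induct)
    case (step p)
    then show ?case
      using assms[of p] by (auto intro: converse_rtrancl_into_rtrancl)
  qed auto
  then show ?thesis using False by simp
qed

section \<open>Cells, lattice points and truncation to the lattice\<close>

definition cell :: "real \<Rightarrow> real^2 \<Rightarrow> int \<times> int" where
  "cell s x = (round (x $ 1 / s), round (x $ 2 / s))"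

definition lattice_point :: "real \<Rightarrow> int \<times> int \<Rightarrow> real^2" where
  "lattice_point s v = vector [s * of_int (fst v), s * of_int (snd v)]"

lemma lattice_point_nth [simp]:
  "lattice_point s v $ 1 = s * of_int (fst v)"
  "lattice_point s v $ 2 = s * of_int (snd v)"
  by (simp_all add: lattice_point_def)

lemma dist_le_sum_2: "dist x (y :: real^2) \<le> \<bar>x $ 1 - y $ 1\<bar> + \<bar>x $ 2 - y $ 2\<bar>"
  using norm_le_l1_cart[of "x - y"] by (simp add: dist_norm sum_2)

lemma norm_square_2: "(norm (x :: real^2))\<^sup>2 = (x $ 1)\<^sup>2 + (x $ 2)\<^sup>2"
  by (simp add: norm_vec_def L2_set_def sum_2)

lemma abs_nth_diff_le_dist: "\<bar>x $ k - y $ k\<bar> \<le> dist x (y :: real^2)"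
  using component_le_norm_cart[of "x - y" k] by (simp add: dist_norm)

lemma norm_lattice_point_le_iff:
  assumes "0 \<le> R"
  shows "norm (lattice_point s (a, b)) \<le> R \<longleftrightarrow> s\<^sup>2 * (of_int a)\<^sup>2 + s\<^sup>2 * (of_int b)\<^sup>2 \<le> R\<^sup>2"
  using assms norm_square_2[of "lattice_point s (a, b)"]
  by (simp add: power_mult_distrib flip: abs_le_square_iff)
     (metis abs_norm_cancel abs_of_nonneg power2_le_iff_abs_le norm_ge_zero)

text \<open>Cells come from rounding to the nearest integer, so they are squares of half-width s/2
  centred at lattice points, and s/3 < s/2. A relay can hence be recovered from the cell in which it
  lies.\<close>

lemma cell_eqI:
  assumes "0 < s" "dist x (lattice_point s v) \<le> s / 3"
  shows "cell s x = v"
proof -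
  have "\<bar>x $ 1 - s * of_int (fst v)\<bar> < s / 2" "\<bar>x $ 2 - s * of_int (snd v)\<bar> < s / 2"
    using abs_nth_diff_le_dist[of x 1 "lattice_point s v"]
      abs_nth_diff_le_dist[of x 2 "lattice_point s v"] assms by simp_all
  then have "\<bar>x $ 1 / s - of_int (fst v)\<bar> < 1 / 2" "\<bar>x $ 2 / s - of_int (snd v)\<bar> < 1 / 2"
    using assms(1) by (simp_all add: field_simps abs_less_iff)
  then show ?thesis
    by (simp add: cell_def round_unique' prod_eq_iff)
qed

text \<open>Rounding is towards zero, not to the nearest integer: no coordinate grows in absolute
  value, so the truncation of a point of the disk stays in the disk. The price is an error up to s
  instead of s/2.\<close>

lemma truncation_exists:
  fixes x s :: real
  assumes "0 < s"
  obtains a :: int where "s\<^sup>2 * (of_int a)\<^sup>2 \<le> x\<^sup>2" "\<bar>x / s - of_int a\<bar> \<le> 1" "\<bar>x - s * of_int a\<bar> \<le> s"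
proof -
  define y where "y = x / s"
  define a where "a = (if 0 \<le> y then \<lfloor>y\<rfloor> else \<lceil>y\<rceil>)"
  have "\<bar>of_int a\<bar> \<le> \<bar>y\<bar> \<and> \<bar>y - of_int a\<bar> \<le> 1"
  proof (cases "0 \<le> y")
    case True
    then show ?thesis by (simp add: a_def) linarith
  next
    case False
    then have "\<lceil>y\<rceil> \<le> 0" by simp
    then show ?thesis using False by (simp add: a_def) linarith
  qed
  then have 1: "\<bar>of_int a\<bar> \<le> \<bar>x / s\<bar>" "\<bar>x / s - of_int a\<bar> \<le> 1"
    by (auto simp: y_def)
  have "\<bar>s * of_int a\<bar> \<le> \<bar>x\<bar>"
    using 1(1) assms by (simp add: abs_mult field_simps)
  then have "s\<^sup>2 * (of_int a)\<^sup>2 \<le> x\<^sup>2"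
    by (metis abs_le_square_iff power_mult_distrib)
  moreover have "\<bar>x - s * of_int a\<bar> \<le> s"
    using 1(2) assms by (simp add: field_simps abs_le_iff)
  ultimately show ?thesis using that 1(2) by blast
qed

text \<open>A deliberate overestimate of the cells that an L-shaped path visits: both legs run along
  grid lines through a truncated coordinate of the source or the destination. It no longer depends
  on which corner is taken, and counting it reduces to counting points in strips.\<close>

definition near_route :: "real \<Rightarrow> config \<Rightarrow> nat \<Rightarrow> int \<times> int \<Rightarrow> bool" where
  "near_route s \<omega> i u \<longleftrightarrow> (\<exists>l\<in>{i, dest \<omega> i}.
     \<bar>loc \<omega> l $ 1 / s - of_int (fst u)\<bar> \<le> 1 \<or> \<bar>loc \<omega> l $ 2 / s - of_int (snd u)\<bar> \<le> 1)"

lemma near_route_source: "near_route s \<omega> i (cell s (loc \<omega> i))"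
proof -
  have "\<bar>loc \<omega> i $ 1 / s - of_int (fst (cell s (loc \<omega> i)))\<bar> \<le> 1"
    using of_int_round_abs_le[of "loc \<omega> i $ 1 / s"] by (simp add: cell_def abs_minus_commute)
  then show ?thesis by (auto simp: near_route_def)
qed

definition relay_map :: "nat \<Rightarrow> real \<Rightarrow> real \<Rightarrow> config \<Rightarrow> (int \<times> int \<Rightarrow> nat) \<Rightarrow> bool" where
  "relay_map n s R \<omega> rel \<longleftrightarrow> (\<forall>v. norm (lattice_point s v) \<le> R \<longrightarrow>
     rel v < n \<and> dist (loc \<omega> (rel v)) (lattice_point s v) \<le> s / 3)"

text \<open>The last property controls the load: a transmitting node is the source or the unique
  relay of its cell, so a route without repetitions transmits at most twice from any one
  cell.\<close>

lemma route_exists: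
  assumes wf: "well_formed_sd n \<omega>" and disk: "\<And>i. i < n \<Longrightarrow> norm (loc \<omega> i) \<le> R"
    and rel: "relay_map n s R \<omega> rel" and s: "0 < s" and i: "i < n"
  obtains rt where "valid_route n \<omega> i rt"
    "\<And>j. j < nhops rt \<Longrightarrow> dist (loc \<omega> (rt ! j)) (loc \<omega> (rt ! Suc j)) \<le> 3 * s"
    "\<And>j. j < nhops rt \<Longrightarrow> near_route s \<omega> i (cell s (loc \<omega> (rt ! j)))"
    "\<And>j. j < nhops rt \<Longrightarrow> rt ! j \<in> {i, rel (cell s (loc \<omega> (rt ! j)))}"
proof -
  \<comment> \<open>All requirements are attached to single edges, so they survive the removal of
    loops. Those on cell and relay concern only the transmitter; the last node of the route only
    receives.\<close>
  define E where "E = {(t, r). t < n \<and> r < n \<and> dist (loc \<omega> t) (loc \<omega> r) \<le> 3 * s \<and>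
    near_route s \<omega> i (cell s (loc \<omega> t)) \<and> t \<in> {i, rel (cell s (loc \<omega> t))}}"
  define d where "d = dest \<omega> i"
  have d: "d < n" "d \<noteq> i" using wf i by (auto simp: well_formed_sd_def d_def)
  have R: "0 \<le> R" using disk[OF i] norm_ge_zero order_trans by blast
  have relD: "rel v < n" "dist (loc \<omega> (rel v)) (lattice_point s v) \<le> s / 3"
    "cell s (loc \<omega> (rel v)) = v" if "norm (lattice_point s v) \<le> R" for v
    using rel that cell_eqI[OF s] unfolding relay_map_def by blast+
  have step: "(rel v, rel w) \<in> E"
    if "norm (lattice_point s v) \<le> R" "norm (lattice_point s w) \<le> R" "near_route s \<omega> i v"
      "\<bar>fst v - fst w\<bar> + \<bar>snd v - snd w\<bar> \<le> 1" for v w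
  proof -
    have "dist (lattice_point s v) (lattice_point s w)
        \<le> s * (\<bar>of_int (fst v) - of_int (fst w)\<bar> + \<bar>of_int (snd v) - of_int (snd w)\<bar>)"
      using dist_le_sum_2[of "lattice_point s v" "lattice_point s w"] s
      by (simp add: abs_mult flip: right_diff_distrib distrib_left)
    also have "\<dots> = s * of_int (\<bar>fst v - fst w\<bar> + \<bar>snd v - snd w\<bar>)" by simp
    also have "\<dots> \<le> s * of_int 1"
      using iffD2[OF of_int_le_iff that(4)] s by (intro mult_left_mono) auto
    finally have "dist (lattice_point s v) (lattice_point s w) \<le> s" by simp
    then have "dist (loc \<omega> (rel v)) (loc \<omega> (rel w)) \<le> 3 * s"
      using relD(2)[OF that(1)] relD(2)[OF that(2)] s
        dist_triangle[of "loc \<omega> (rel v)" "loc \<omega> (rel w)" "lattice_point s v"]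
        dist_triangle2[of "lattice_point s v" "loc \<omega> (rel w)" "lattice_point s w"]
      by linarith
    then show ?thesis using relD that by (simp add: E_def)
  qed
  \<comment> \<open>Along a segment the varying coordinate is in absolute value at most that of one
    of the ends, so a row or column segment between two lattice points of the disk never leaves the
    disk.\<close>
  have between: "(of_int p :: real)\<^sup>2 \<le> max ((of_int a)\<^sup>2) ((of_int b)\<^sup>2)"
    if "min a b \<le> p" "p \<le> max a b" for p a b :: int
  proof -
    have "\<bar>p\<bar> \<le> max \<bar>a\<bar> \<bar>b\<bar>" using that by linarith
    then have "\<bar>p\<bar> \<le> \<bar>a\<bar> \<or> \<bar>p\<bar> \<le> \<bar>b\<bar>" by linarith
    then have "p\<^sup>2 \<le> a\<^sup>2 \<or> p\<^sup>2 \<le> b\<^sup>2" by (simp only: abs_le_square_iff)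
    then have "(of_int (p\<^sup>2) :: real) \<le> of_int (a\<^sup>2) \<or> (of_int (p\<^sup>2) :: real) \<le> of_int (b\<^sup>2)"
      by (simp only: of_int_le_iff)
    then show ?thesis by auto
  qed
  have row: "(rel (a, b), rel (a', b)) \<in> E\<^sup>*"
    if "norm (lattice_point s (a, b)) \<le> R" "norm (lattice_point s (a', b)) \<le> R"
      "\<And>p. near_route s \<omega> i (p, b)" for a a' b
  proof (rule int_segment_rtrancl[of _ _ "\<lambda>p. rel (p, b)"])
    fix p assume p: "min a a' \<le> p" "p < max a a'"
    have "norm (lattice_point s (q, b)) \<le> R" if "min a a' \<le> q" "q \<le> max a a'" for q
    proof -
      have "s\<^sup>2 * (of_int q)\<^sup>2 \<le> s\<^sup>2 * max ((of_int a)\<^sup>2) ((of_int a')\<^sup>2)"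
        using between[OF that] by (intro mult_left_mono) auto
      then show ?thesis
        using \<open>norm (lattice_point s (a, b)) \<le> R\<close> \<open>norm (lattice_point s (a', b)) \<le> R\<close>
        by (auto simp: norm_lattice_point_le_iff[OF R] max_def split: if_splits)
    qed
    then show "(rel (p, b), rel (p + 1, b)) \<in> E \<and> (rel (p + 1, b), rel (p, b)) \<in> E"
      using p that(3) by (intro conjI step) auto
  qed
  have col: "(rel (a, b), rel (a, b')) \<in> E\<^sup>*"
    if "norm (lattice_point s (a, b)) \<le> R" "norm (lattice_point s (a, b')) \<le> R"
      "\<And>p. near_route s \<omega> i (a, p)" for a b b'
  proof (rule int_segment_rtrancl[of _ _ "\<lambda>p. rel (a, p)"])
    fix p assume p: "min b b' \<le> p" "p < max b b'"
    have "norm (lattice_point s (a, q)) \<le> R" if "min b b' \<le> q" "q \<le> max b b'" for q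
    proof -
      have "s\<^sup>2 * (of_int q)\<^sup>2 \<le> s\<^sup>2 * max ((of_int b)\<^sup>2) ((of_int b')\<^sup>2)"
        using between[OF that] by (intro mult_left_mono) auto
      then show ?thesis
        using \<open>norm (lattice_point s (a, b)) \<le> R\<close> \<open>norm (lattice_point s (a, b')) \<le> R\<close>
        by (auto simp: norm_lattice_point_le_iff[OF R] max_def split: if_splits)
    qed
    then show "(rel (a, p), rel (a, p + 1)) \<in> E \<and> (rel (a, p + 1), rel (a, p)) \<in> E"
      using p that(3) by (intro conjI step) auto
  qed
  obtain a where a: "s\<^sup>2 * (of_int a)\<^sup>2 \<le> (loc \<omega> i $ 1)\<^sup>2" "\<bar>loc \<omega> i $ 1 / s - of_int a\<bar> \<le> 1"
    "\<bar>loc \<omega> i $ 1 - s * of_int a\<bar> \<le> s"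
    using truncation_exists[OF s] .
  obtain b where b: "s\<^sup>2 * (of_int b)\<^sup>2 \<le> (loc \<omega> i $ 2)\<^sup>2" "\<bar>loc \<omega> i $ 2 / s - of_int b\<bar> \<le> 1"
    "\<bar>loc \<omega> i $ 2 - s * of_int b\<bar> \<le> s"
    using truncation_exists[OF s] .
  obtain a' where a': "s\<^sup>2 * (of_int a')\<^sup>2 \<le> (loc \<omega> d $ 1)\<^sup>2" "\<bar>loc \<omega> d $ 1 / s - of_int a'\<bar> \<le> 1"
    "\<bar>loc \<omega> d $ 1 - s * of_int a'\<bar> \<le> s"
    using truncation_exists[OF s] .
  obtain b' where b': "s\<^sup>2 * (of_int b')\<^sup>2 \<le> (loc \<omega> d $ 2)\<^sup>2" "\<bar>loc \<omega> d $ 2 / s - of_int b'\<bar> \<le> 1"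
    "\<bar>loc \<omega> d $ 2 - s * of_int b'\<bar> \<le> s"
    using truncation_exists[OF s] .
  have near: "near_route s \<omega> i (a, p)" "near_route s \<omega> i (p, b)"
    "near_route s \<omega> i (a', p)" "near_route s \<omega> i (p, b')" for p
    using a(2) b(2) a'(2) b'(2) by (auto simp: near_route_def d_def)
  have sq: "(norm (loc \<omega> l))\<^sup>2 \<le> R\<^sup>2" if "l < n" for l
    using disk[OF that] by (simp add: power_mono)
  have ends: "norm (lattice_point s (a, b)) \<le> R" "norm (lattice_point s (a', b')) \<le> R"
    using a(1) b(1) a'(1) b'(1) sq[OF i] sq[OF d(1)]
    by (auto simp: norm_lattice_point_le_iff[OF R] norm_square_2)
  \<comment> \<open>The squared norms of the two corners have the same sum as those of the two ends,
    hence at most 2 R^2, so one corner has squared norm at most R^2.\<close>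
  have corner: "norm (lattice_point s (a', b)) \<le> R \<or> norm (lattice_point s (a, b')) \<le> R"
    using ends by (auto simp: norm_lattice_point_le_iff[OF R])
  have first: "(i, rel (a, b)) \<in> E"
  proof -
    \<comment> \<open>Truncation moves each coordinate by at most s; adding the distance s/3 from
      lattice point to relay stays within 3 s.\<close>
    have "dist (loc \<omega> i) (lattice_point s (a, b)) \<le> 2 * s"
      using dist_le_sum_2[of "loc \<omega> i" "lattice_point s (a, b)"] a(3) b(3) by simp
    then have "dist (loc \<omega> i) (loc \<omega> (rel (a, b))) \<le> 3 * s"
      using relD(2)[OF ends(1)] s
        dist_triangle2[of "loc \<omega> i" "loc \<omega> (rel (a, b))" "lattice_point s (a, b)"]
      by linarith
    then show ?thesis
      using relD[OF ends(1)] near_route_source i by (auto simp: E_def)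
  qed
  have last: "(rel (a', b'), d) \<in> E"
  proof -
    have "dist (loc \<omega> d) (lattice_point s (a', b')) \<le> 2 * s"
      using dist_le_sum_2[of "loc \<omega> d" "lattice_point s (a', b')"] a'(3) b'(3) by simp
    then have "dist (loc \<omega> (rel (a', b'))) (loc \<omega> d) \<le> 3 * s"
      using relD(2)[OF ends(2)] s
        dist_triangle2[of "loc \<omega> (rel (a', b'))" "loc \<omega> d" "lattice_point s (a', b')"]
      by linarith
    then show ?thesis
      using relD[OF ends(2)] near d by (auto simp: E_def)
  qed
  have "(rel (a, b), rel (a', b')) \<in> E\<^sup>*"
    using corner
  proof
    assume "norm (lattice_point s (a', b)) \<le> R"
    then show ?thesis
      using row[OF ends(1) _ near(2)] col[OF _ ends(2) near(3)] by (meson rtrancl_trans)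
  next
    assume "norm (lattice_point s (a, b')) \<le> R"
    then show ?thesis
      using col[OF ends(1) _ near(1)] row[OF _ ends(2) near(4)] by (meson rtrancl_trans)
  qed
  then have "(i, d) \<in> E\<^sup>*"
    using first last by (meson converse_rtrancl_into_rtrancl rtrancl_into_rtrancl)
  from rtrancl_distinct_path[OF this] obtain rt where rt: "rt \<noteq> []" "hd rt = i" "List.last rt = d"
    "distinct rt" "\<And>j. Suc j < length rt \<Longrightarrow> (rt ! j, rt ! Suc j) \<in> E"
    by blast
  have len: "2 \<le> length rt"
  proof (rule ccontr)
    assume "\<not> 2 \<le> length rt"
    then have "length rt = 1" using rt(1) by (cases rt) (auto simp: not_le)
    then show False using rt(2,3) d(2) by (auto simp: length_Suc_conv)
  qed
  have hop: "(rt ! j, rt ! Suc j) \<in> E" if "j < nhops rt" for j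
    using that rt(5) by (auto simp: nhops_def)
  have "set rt \<subseteq> {..<n}"
  proof
    fix x assume "x \<in> set rt"
    then obtain j where j: "j < length rt" "x = rt ! j" by (auto simp: in_set_conv_nth)
    show "x \<in> {..<n}"
    proof (cases "Suc j < length rt")
      case True
      then show ?thesis using rt(5)[OF True] j by (auto simp: E_def)
    next
      case False
      then have "x = d" using j rt(1,3) by (metis Suc_lessI diff_Suc_1 last_conv_nth)
      then show ?thesis using d by simp
    qed
  qed
  then have "valid_route n \<omega> i rt"
    using rt len by (simp add: valid_route_def d_def)
  then show ?thesis
    using that[of rt] hop by (simp add: E_def)
qed

subsection \<open>Interference between separated cells\<close>

text \<open>Absolute value is injective on the nonnegative and on the negative integers, so each
  half is a partial sum of the convergent series over the naturals; hence the factor 2.\<close>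

lemma inverse_powr_int_sum_bounded:
  fixes a :: real
  assumes "1 < a"
  obtains Z :: real where "0 < Z" "\<And>F :: int set. finite F \<Longrightarrow> (\<Sum>p\<in>F. (1 + \<bar>of_int p\<bar>) powr - a) \<le> Z"
proof -
  have summable: "summable (\<lambda>k. (1 + real k) powr - a)"
    using summable_real_powr_iff[of "- a"] assms
    by (subst (asm) summable_Suc_iff[symmetric]) (simp add: add.commute)
  define Z where "Z = 2 * (\<Sum>k. (1 + real k) powr - a)"
  have "(\<Sum>p\<in>F. (1 + \<bar>of_int p\<bar>) powr - a) \<le> Z" if F: "finite F" for F :: "int set"
  proof -
    have half: "(\<Sum>p\<in>G. (1 + \<bar>of_int p\<bar>) powr - a) \<le> (\<Sum>k. (1 + real k) powr - a)"
      if "finite G" "inj_on (\<lambda>p. nat \<bar>p\<bar>) G" for G :: "int set"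
    proof -
      have "(\<Sum>p\<in>G. (1 + \<bar>of_int p\<bar>) powr - a) = (\<Sum>k\<in>(\<lambda>p. nat \<bar>p\<bar>) ` G. (1 + real k) powr - a)"
        using that by (subst sum.reindex) (auto intro!: sum.cong)
      also have "\<dots> \<le> (\<Sum>k. (1 + real k) powr - a)"
        using that summable by (intro sum_le_suminf) auto
      finally show ?thesis .
    qed
    have "F = {p\<in>F. 0 \<le> p} \<union> {p\<in>F. p < 0}" by auto
    then have "(\<Sum>p\<in>F. (1 + \<bar>of_int p\<bar>) powr - a)
        = (\<Sum>p\<in>{p\<in>F. 0 \<le> p}. (1 + \<bar>of_int p\<bar>) powr - a) + (\<Sum>p\<in>{p\<in>F. p < 0}. (1 + \<bar>of_int p\<bar>) powr - a)"
      using F by (subst sum.union_disjoint[symmetric]) auto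
    also have "\<dots> \<le> Z"
      unfolding Z_def mult_2 using F by (intro add_mono half) (auto simp: inj_on_def)
    finally show ?thesis .
  qed
  moreover have "0 < Z"
    unfolding Z_def using summable by (intro mult_pos_pos suminf_pos2[of _ 0]) auto
  ultimately show ?thesis using that by blast
qed

text \<open>The point is the factor (s M)^(-alpha): it has the same power of s as the signal over a
  hop of length 3 s, and it is made small by M alone. The exponent alpha/2 in the hypothesis on
  \<open>Z\<close> is where alpha > 2 will enter.\<close>

lemma sum_eta_le:
  fixes s \<alpha> :: real and M :: nat
  assumes \<alpha>: "0 < \<alpha>" and s: "0 < s" and M: "8 \<le> M"
    and Z: "\<And>F :: int set. finite F \<Longrightarrow> (\<Sum>p\<in>F. (1 + \<bar>of_int p\<bar>) powr - (\<alpha> / 2)) \<le> Z"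
    and T: "finite T" "inj_on (cell s) T" and tr: "dist t r \<le> 3 * s"
    and cells: "\<And>t'. t' \<in> T \<Longrightarrow> cell s t' \<noteq> cell s t"
      "\<And>t'. t' \<in> T \<Longrightarrow> int M dvd fst (cell s t') - fst (cell s t)"
      "\<And>t'. t' \<in> T \<Longrightarrow> int M dvd snd (cell s t') - snd (cell s t)"
  shows "(\<Sum>t'\<in>T. eta \<alpha> (dist t' r)) \<le> Z\<^sup>2 * 4 powr \<alpha> * (s * real M) powr - \<alpha>"
proof -
  \<comment> \<open>The position of the cell of t' in the sublattice of mesh M around the cell of t.
    It is injective on T and never (0, 0), so the interferers are indexed by distinct nonzero
    integer vectors.\<close>
  define w where "w t' = ((fst (cell s t') - fst (cell s t)) div int M,
    (snd (cell s t') - snd (cell s t)) div int M)" for t'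
  define h where "h p = (1 + \<bar>real_of_int p\<bar>) powr - (\<alpha> / 2)" for p :: int
  have wM: "fst (cell s t') - fst (cell s t) = int M * fst (w t')"
    "snd (cell s t') - snd (cell s t) = int M * snd (w t')" if "t' \<in> T" for t'
    using cells(2,3)[OF that] by (simp_all add: w_def)
  have inj: "inj_on w T"
  proof (rule inj_onI)
    fix x y assume "x \<in> T" "y \<in> T" "w x = w y"
    then have "cell s x = cell s y" using wM[of x] wM[of y] by (simp add: prod_eq_iff)
    then show "x = y" using T(2) \<open>x \<in> T\<close> \<open>y \<in> T\<close> by (auto dest: inj_onD)
  qed
  have term_le: "eta \<alpha> (dist t' r) \<le> 4 powr \<alpha> * (s * real M) powr - \<alpha> * (h (fst (w t')) * h (snd (w t')))"
    if t': "t' \<in> T" for t'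
  proof -
    define k :: real where "k = max \<bar>of_int (fst (w t'))\<bar> \<bar>of_int (snd (w t'))\<bar>"
    have "w t' \<noteq> (0, 0)" using cells(1)[OF t'] wM[OF t'] by (auto simp: prod_eq_iff)
    then have "1 \<le> max \<bar>fst (w t')\<bar> \<bar>snd (w t')\<bar>" by (cases "w t'") auto
    then have "of_int 1 \<le> (of_int (max \<bar>fst (w t')\<bar> \<bar>snd (w t')\<bar>) :: real)" by (simp only: of_int_le_iff)
    then have k: "1 \<le> k" by (simp add: k_def of_int_max)
    \<comment> \<open>Each of the two roundings is off by at most 1/2, a loss of one mesh
      unit.\<close>
    have coord: "s * (real M * \<bar>of_int p\<bar> - 1) \<le> \<bar>x - y\<bar>"
      if "round (x / s) - round (y / s) = int M * p" for x y and p :: int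
    proof -
      have "real_of_int (round (x / s) - round (y / s)) = of_int (int M * p)" using that by simp
      then have "real_of_int (round (x / s)) - of_int (round (y / s)) = real M * of_int p" by simp
      moreover have "\<bar>real M * of_int p\<bar> = real M * \<bar>of_int p\<bar>" by (simp add: abs_mult)
      ultimately have "real M * \<bar>of_int p\<bar> - 1 \<le> \<bar>x / s - y / s\<bar>"
        using of_int_round_abs_le[of "x / s"] of_int_round_abs_le[of "y / s"] by linarith
      also have "\<dots> = \<bar>x - y\<bar> / s" using s by (simp flip: diff_divide_distrib)
      finally show ?thesis using s by (simp add: field_simps)
    qed
    have "s * (real M * \<bar>of_int (fst (w t'))\<bar> - 1) \<le> dist t' t"
      "s * (real M * \<bar>of_int (snd (w t'))\<bar> - 1) \<le> dist t' t"
      using coord[of "t' $ 1" "t $ 1"] coord[of "t' $ 2" "t $ 2"] wM[OF t']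
        abs_nth_diff_le_dist[of t' 1 t] abs_nth_diff_le_dist[of t' 2 t]
      by (fastforce simp: cell_def)+
    then have "s * (real M * k - 1) \<le> dist t' t" by (auto simp: k_def max_def)
    \<comment> \<open>The loss of 4 mesh units is 1 from rounding and 3 from the hop length. Since M
      k >= 8, it is at most half of M k, and k >= 1 turns k/2 into (1 + k)/4.\<close>
    then have "s * (real M * k - 4) \<le> dist t' r"
      using tr dist_triangle[of t' t r] by (simp add: algebra_simps dist_commute)
    moreover have "8 * 1 \<le> real M * k" using M k by (intro mult_mono) auto
    then have "s * (real M * k / 2) \<le> s * (real M * k - 4)" using s by (intro mult_left_mono) (auto simp: mult.commute)
    moreover have "s * real M * ((1 + k) / 4) \<le> s * real M * (k / 2)"
      using s k by (intro mult_left_mono) auto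
    ultimately have "s * real M / 4 * (1 + k) \<le> 1 + dist t' r" by simp
    then have "(s * real M / 4 * (1 + k)) powr \<alpha> \<le> (1 + dist t' r) powr \<alpha>"
      using s k \<alpha> by (intro powr_mono2) auto
    then have "eta \<alpha> (dist t' r) \<le> 1 / (s * real M / 4 * (1 + k)) powr \<alpha>"
      unfolding eta_def using s k M by (intro divide_left_mono mult_pos_pos) (auto simp: powr_gt_zero)
    also have "\<dots> = 4 powr \<alpha> * (s * real M) powr - \<alpha> * (1 + k) powr - \<alpha>"
    proof -
      have split: "(s * real M / 4 * (1 + k)) powr \<alpha> = (s * real M) powr \<alpha> / 4 powr \<alpha> * (1 + k) powr \<alpha>"
        using s k by (simp only: powr_mult[of "s * real M / 4"] powr_divide)
      show ?thesis unfolding split powr_minus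
        by (simp only: divide_inverse inverse_mult_distrib inverse_inverse_eq mult_1 mult_ac)
    qed
    \<comment> \<open>Bounding the maximum norm by a product makes the sum over the plane a product of two sums over the integers.\<close>
    also have "(1 + k) powr - \<alpha> = (1 + k) powr - (\<alpha> / 2) * (1 + k) powr - (\<alpha> / 2)"
      using k by (simp flip: powr_add)
    also have "\<dots> \<le> h (fst (w t')) * h (snd (w t'))"
      unfolding h_def k_def using \<alpha>
      by (intro mult_mono powr_mono2') auto
    finally show ?thesis by (simp add: mult_left_mono)
  qed
  define F G where "F = fst ` w ` T" and "G = snd ` w ` T"
  have FG: "finite F" "finite G" using T by (auto simp: F_def G_def)
  have "(\<Sum>t'\<in>T. h (fst (w t')) * h (snd (w t'))) = (\<Sum>u\<in>w ` T. h (fst u) * h (snd u))"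
    using inj by (simp add: sum.reindex)
  also have "\<dots> \<le> (\<Sum>u\<in>F \<times> G. h (fst u) * h (snd u))"
    using FG by (intro sum_mono2 subsetI) (auto simp: F_def G_def h_def mem_Times_iff)
  also have "\<dots> = (\<Sum>p\<in>F. h p) * (\<Sum>p\<in>G. h p)"
    by (simp add: sum_product sum.cartesian_product case_prod_unfold)
  also have "\<dots> \<le> Z * Z"
    \<comment> \<open>The empty sum supplies 0 <= Z, needed to multiply the two bounds.\<close>
    using Z[of F] Z[of G] Z[of "{}"] FG unfolding h_def
    by (intro mult_mono) (auto intro!: sum_nonneg)
  finally have hh: "(\<Sum>t'\<in>T. h (fst (w t')) * h (snd (w t'))) \<le> Z\<^sup>2" by (simp add: power2_eq_square)
  have "(\<Sum>t'\<in>T. eta \<alpha> (dist t' r))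
      \<le> (\<Sum>t'\<in>T. 4 powr \<alpha> * (s * real M) powr - \<alpha> * (h (fst (w t')) * h (snd (w t'))))"
    using term_le by (intro sum_mono) auto
  also have "\<dots> = 4 powr \<alpha> * (s * real M) powr - \<alpha> * (\<Sum>t'\<in>T. h (fst (w t')) * h (snd (w t')))"
    by (simp add: sum_distrib_left)
  also have "\<dots> \<le> 4 powr \<alpha> * (s * real M) powr - \<alpha> * Z\<^sup>2"
    using hh by (intro mult_left_mono) auto
  finally show ?thesis by (simp add: mult_ac)
qed

text \<open>Noise, power and mesh are quantified inside, so that a suitable M depends on alpha and
  beta only; the constants of the theorem inherit this.\<close>

definition separated_SINR :: "real \<Rightarrow> real \<Rightarrow> nat \<Rightarrow> bool" where
  "separated_SINR \<alpha> \<beta> M \<longleftrightarrow> (\<forall>No P s t r T. 0 < No \<longrightarrow> 1 \<le> s \<longrightarrow>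
     2 * \<beta> * No * (4 * s) powr \<alpha> \<le> P \<longrightarrow> dist t r \<le> 3 * s \<longrightarrow> finite T \<longrightarrow> inj_on (cell s) T \<longrightarrow>
     (\<forall>t'\<in>T. cell s t' \<noteq> cell s t \<and> int M dvd fst (cell s t') - fst (cell s t) \<and>
        int M dvd snd (cell s t') - snd (cell s t)) \<longrightarrow>
     SINR_ok \<alpha> \<beta> No P t r T)"

text \<open>The signal is at least P (4 s)^(-alpha), since 1 + 3 s <= 4 s. Half of it pays for beta
  times the noise, by the assumed lower bound on P, and half for beta times the interference, by the
  choice of M.\<close>

lemma separated_SINR_exists:
  assumes \<alpha>: "2 < \<alpha>" and \<beta>: "0 < \<beta>"
  obtains M :: nat where "0 < M" "separated_SINR \<alpha> \<beta> M"
proof -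
  obtain Z :: real where Z: "0 < Z"
    "\<And>F :: int set. finite F \<Longrightarrow> (\<Sum>p\<in>F. (1 + \<bar>of_int p\<bar>) powr - (\<alpha> / 2)) \<le> Z"
    using inverse_powr_int_sum_bounded[of "\<alpha> / 2"] \<alpha> by auto
  define C where "C = Z\<^sup>2 * 4 powr \<alpha>"
  \<comment> \<open>M^alpha >= \<open>B\<close> says exactly that 2 beta C (s M)^(-alpha) <= (4
    s)^(-alpha), from which s cancels.\<close>
  define B where "B = 2 * \<beta> * C * 4 powr \<alpha>"
  have pos: "0 < C" "0 < B" using Z(1) \<beta> by (auto simp: C_def B_def)
  obtain M :: nat where M: "max 8 (B powr (1 / \<alpha>)) \<le> real M" using real_arch_simple by blast
  have "B = (B powr (1 / \<alpha>)) powr \<alpha>" using pos \<alpha> by (simp add: powr_powr)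
  also have "\<dots> \<le> real M powr \<alpha>" using M \<alpha> by (intro powr_mono2) auto
  finally have BM: "B \<le> real M powr \<alpha>" .
  have M8: "8 \<le> M" using M by simp
  have "SINR_ok \<alpha> \<beta> No P t r T"
    if No: "0 < No" and s: "1 \<le> s" and P: "2 * \<beta> * No * (4 * s) powr \<alpha> \<le> P"
      and tr: "dist t r \<le> 3 * s" and T: "finite T" "inj_on (cell s) T"
      and sep: "\<forall>t'\<in>T. cell s t' \<noteq> cell s t \<and> int M dvd fst (cell s t') - fst (cell s t) \<and>
        int M dvd snd (cell s t') - snd (cell s t)"
    for No P s t r T
  proof -
    define I where "I = (\<Sum>t'\<in>T. eta \<alpha> (dist t' r))"
    have P0: "0 < P" using P No \<beta> s by (intro less_le_trans[OF _ P]) simp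
    have I0: "0 \<le> I" by (auto simp: I_def eta_def intro!: sum_nonneg)
    have "I \<le> C * (s * real M) powr - \<alpha>"
      unfolding I_def C_def using sum_eta_le[OF _ _ M8 Z(2) T tr] s sep \<alpha> by simp
    then have "2 * \<beta> * I \<le> 2 * \<beta> * (C * (s * real M) powr - \<alpha>)" using \<beta> by (intro mult_left_mono) auto
    also have "\<dots> = B / real M powr \<alpha> * (4 * s) powr - \<alpha>"
      using s by (simp add: B_def powr_mult powr_minus field_simps)
    also have "\<dots> \<le> 1 * (4 * s) powr - \<alpha>"
      using BM M8 pos by (intro mult_right_mono) (auto simp: divide_le_eq)
    finally have I: "2 * \<beta> * I \<le> (4 * s) powr - \<alpha>" by simp
    have "2 * \<beta> * No * ((4 * s) powr \<alpha> * (4 * s) powr - \<alpha>) \<le> P * (4 * s) powr - \<alpha>"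
      using P by (simp add: mult_right_mono flip: mult.assoc)
    then have N: "2 * \<beta> * No \<le> P * (4 * s) powr - \<alpha>" using s by (simp add: powr_minus)
    have "(4 * s) powr - \<alpha> \<le> (1 + dist t r) powr - \<alpha>"
      using s tr \<alpha> by (intro powr_mono2') (auto intro: add_pos_nonneg)
    also have "\<dots> = eta \<alpha> (dist t r)"
      by (simp add: eta_def powr_minus divide_inverse)
    finally have "P * (4 * s) powr - \<alpha> \<le> P * eta \<alpha> (dist t r)" using P0 by simp
    moreover have "P * (2 * \<beta> * I) \<le> P * (4 * s) powr - \<alpha>" using I P0 by simp
    ultimately have "\<beta> * (No + P * I) \<le> P * eta \<alpha> (dist t r)"
      using N by (simp add: algebra_simps)
    moreover have "0 < No + P * I" using No P0 I0 by (simp add: add_pos_nonneg)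
    ultimately show ?thesis
      unfolding SINR_ok_def I_def by (simp add: pos_le_divide_eq sum_distrib_left)
  qed
  then have "separated_SINR \<alpha> \<beta> M" unfolding separated_SINR_def by blast
  then show ?thesis using that[of M] M8 by simp
qed

subsection \<open>Scheduling a good configuration\<close>

text \<open>The bound 4 n s / R is twice an upper estimate 2 n s / R for the mean number of points
  in a strip. The range R/s + 1 for p contains every rounded coordinate of a point of the disk and
  keeps the number of strips finite.\<close>

definition good_config :: "nat \<Rightarrow> real \<Rightarrow> real \<Rightarrow> config \<Rightarrow> bool" where
  "good_config n s R \<omega> \<longleftrightarrow> well_formed_sd n \<omega> \<and> (\<forall>i<n. norm (loc \<omega> i) \<le> R) \<and>
     (\<exists>rel. relay_map n s R \<omega> rel) \<and>
     (\<forall>k. \<forall>p :: int. \<bar>of_int p\<bar> \<le> R / s + 1 \<longrightarrow>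
        real (card {i. i < n \<and> \<bar>loc \<omega> i $ k / s - of_int p\<bar> \<le> 1}) \<le> 4 * (real n * s / R) \<and>
        real (card {i. i < n \<and> \<bar>loc \<omega> (dest \<omega> i) $ k / s - of_int p\<bar> \<le> 1}) \<le> 4 * (real n * s / R))"

text \<open>Four strips matter, the row and the column of the cell, each for sources and for
  destinations: 16 = 4 * 4.\<close>

lemma card_near_route_le:
  assumes "good_config n s R \<omega>" "0 < s" "norm x \<le> R"
  shows "real (card {i. i < n \<and> near_route s \<omega> i (cell s x)}) \<le> 16 * (real n * s / R)"
proof -
  let ?src = "\<lambda>k p. {i. i < n \<and> \<bar>loc \<omega> i $ k / s - real_of_int p\<bar> \<le> 1}"
  let ?dst = "\<lambda>k p. {i. i < n \<and> \<bar>loc \<omega> (dest \<omega> i) $ k / s - real_of_int p\<bar> \<le> 1}"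
  obtain a b where ab: "cell s x = (a, b)" by fastforce
  have range: "\<bar>real_of_int (round (y / s))\<bar> \<le> R / s + 1" if "\<bar>y\<bar> \<le> R" for y
  proof -
    have "\<bar>y / s\<bar> \<le> R / s" using that assms(2) by (simp add: field_simps)
    then show ?thesis using of_int_round_abs_le[of "y / s"] by linarith
  qed
  have "\<bar>x $ 1\<bar> \<le> R" "\<bar>x $ 2\<bar> \<le> R"
    using assms(3) component_le_norm_cart order_trans by blast+
  then have "\<bar>real_of_int a\<bar> \<le> R / s + 1" "\<bar>real_of_int b\<bar> \<le> R / s + 1"
    using ab range by (auto simp: cell_def)
  then have bounds: "real (card (?src 1 a)) \<le> 4 * (real n * s / R)" "real (card (?src 2 b)) \<le> 4 * (real n * s / R)"
    "real (card (?dst 1 a)) \<le> 4 * (real n * s / R)" "real (card (?dst 2 b)) \<le> 4 * (real n * s / R)"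
    using assms(1) unfolding good_config_def by blast+
  have "{i. i < n \<and> near_route s \<omega> i (cell s x)} \<subseteq> (?src 1 a \<union> ?src 2 b) \<union> (?dst 1 a \<union> ?dst 2 b)"
    by (auto simp: near_route_def ab)
  then have "card {i. i < n \<and> near_route s \<omega> i (cell s x)}
      \<le> card ((?src 1 a \<union> ?src 2 b) \<union> (?dst 1 a \<union> ?dst 2 b))"
    by (intro card_mono) auto
  also have "\<dots> \<le> (card (?src 1 a) + card (?src 2 b)) + (card (?dst 1 a) + card (?dst 2 b))"
    by (meson add_mono card_Un_le order_trans)
  finally have "real (card {i. i < n \<and> near_route s \<omega> i (cell s x)})
      \<le> (real (card (?src 1 a)) + real (card (?src 2 b))) + (real (card (?dst 1 a)) + real (card (?dst 2 b)))"
    by (simp only: of_nat_le_iff flip: of_nat_add)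
  also have "\<dots> \<le> (4 * (real n * s / R) + 4 * (real n * s / R)) + (4 * (real n * s / R) + 4 * (real n * s / R))"
    by (intro add_mono bounds)
  finally show ?thesis by (simp add: mult.commute)
qed

text \<open>The factor 32 M^2 is made of 16 n s / R routes near a cell, two hops per route from one
  cell, and M^2 classes of cells taking turns.\<close>

lemma good_system_exists:
  assumes M: "0 < M" "separated_SINR \<alpha> \<beta> M" and good: "good_config n s R \<omega>"
    and n: "2 \<le> n" and s: "1 \<le> s" and No: "0 < No" and P: "2 * \<beta> * No * (4 * s) powr \<alpha> \<le> P"
  shows "\<exists>S. is_system n \<omega> S \<and> SINR_successful \<alpha> \<beta> No P n \<omega> S \<and>
    0 < period n S \<and> real (period n S) \<le> 32 * (real M)\<^sup>2 * (real n * s / R)"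
proof -
  have s0: "0 < s" using s by simp
  obtain rel where wf: "well_formed_sd n \<omega>" and disk: "\<And>i. i < n \<Longrightarrow> norm (loc \<omega> i) \<le> R"
    and rel: "relay_map n s R \<omega> rel"
    using good by (auto simp: good_config_def)
  have "\<exists>rt. valid_route n \<omega> i rt \<and>
      (\<forall>j<nhops rt. dist (loc \<omega> (rt ! j)) (loc \<omega> (rt ! Suc j)) \<le> 3 * s \<and>
        near_route s \<omega> i (cell s (loc \<omega> (rt ! j))) \<and>
        rt ! j \<in> {i, rel (cell s (loc \<omega> (rt ! j)))})" if "i < n" for i
    using route_exists[OF wf disk rel s0 that] by metis
  then obtain rt where rt: "\<And>i. i < n \<Longrightarrow> valid_route n \<omega> i (rt i)"
    "\<And>i j. i < n \<Longrightarrow> j < nhops (rt i) \<Longrightarrow> dist (loc \<omega> (rt i ! j)) (loc \<omega> (rt i ! Suc j)) \<le> 3 * s"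
    "\<And>i j. i < n \<Longrightarrow> j < nhops (rt i) \<Longrightarrow> near_route s \<omega> i (cell s (loc \<omega> (rt i ! j)))"
    "\<And>i j. i < n \<Longrightarrow> j < nhops (rt i) \<Longrightarrow> rt i ! j \<in> {i, rel (cell s (loc \<omega> (rt i ! j)))}"
    by metis
  have node: "rt i ! j < n" if "i < n" "j < nhops (rt i)" for i j
    using rt(1)[OF that(1)] that(2) by (auto simp: valid_route_def nhops_def subset_iff)
  define J where "J = (SIGMA i:{..<n}. {..<nhops (rt i)})"
  define u where "u h = cell s (loc \<omega> (rt (fst h) ! snd h))" for h
  define H where "H v = {h \<in> J. u h = v}" for v
  have finJ: "finite J" by (simp add: J_def)
  then have finH: "finite (H v)" for v by (simp add: H_def)
  have "\<forall>v. \<exists>f. bij_betw f (H v) {0..<card (H v)}"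
    using ex_bij_betw_finite_nat[OF finH] by blast
  then obtain f where f: "\<And>v. bij_betw (f v) (H v) {0..<card (H v)}" by metis
  \<comment> \<open>The two residues modulo M are the digits of a number below M^2.\<close>
  define colour where "colour v = nat (fst v mod int M) + M * nat (snd v mod int M)" for v :: "int \<times> int"
  \<comment> \<open>\<open>f\<close> enumerates the hops transmitted from one cell. Because
    \<open>colour\<close> is below M^2, class and index are recovered by \<open>mod\<close> and
    \<open>div\<close> after subtracting the 1 that makes slots positive.\<close>
  define slot where "slot h = 1 + (colour (u h) + M\<^sup>2 * f (u h) h)" for h
  have colour_less: "colour v < M\<^sup>2" for v
  proof -
    have "nat (fst v mod int M) < M" "nat (snd v mod int M) \<le> M - 1"
      using M(1) pos_mod_bound[of "int M"] by (auto simp: nat_less_iff nat_le_iff of_nat_diff intro: zle_diff1_eq[THEN iffD2])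
    then have "colour v < M + M * (M - 1)"
      unfolding colour_def by (intro add_less_le_mono mult_left_mono) auto
    also have "\<dots> = M\<^sup>2" using M(1) by (simp add: power2_eq_square algebra_simps)
    finally show ?thesis .
  qed
  have colour_eq: "int M dvd fst v - fst w" "int M dvd snd v - snd w" if "colour v = colour w" for v w
  proof -
    have lt: "nat (fst x mod int M) < M" for x :: "int \<times> int"
      using M(1) by (simp add: nat_less_iff)
    have "colour x mod M = nat (fst x mod int M)" "colour x div M = nat (snd x mod int M)" for x
      unfolding colour_def using lt[of x] M(1) by simp_all
    then have "nat (fst v mod int M) = nat (fst w mod int M)" "nat (snd v mod int M) = nat (snd w mod int M)"
      using that by metis+
    then have "fst v mod int M = fst w mod int M" "snd v mod int M = snd w mod int M"
      using M(1) by (simp_all add: nat_eq_iff)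
    then show "int M dvd fst v - fst w" "int M dvd snd v - snd w"
      by (simp_all add: mod_eq_dvd_iff)
  qed
  have slot_eq: "colour (u h) = colour (u h')" "u h = u h' \<Longrightarrow> h = h'"
    if "h \<in> J" "h' \<in> J" "slot h = slot h'" for h h'
  proof -
    have *: "(slot x - 1) mod M\<^sup>2 = colour (u x)" "(slot x - 1) div M\<^sup>2 = f (u x) x" for x
      unfolding slot_def using colour_less[of "u x"] M(1) by (simp_all add: div_add1_eq)
    show "colour (u h) = colour (u h')" using *(1) that(3) by metis
    assume eq: "u h = u h'"
    have "f (u h) h = f (u h) h'" using *(2) that(3) eq by metis
    moreover have "inj_on (f (u h)) (H (u h))" using f bij_betw_def by blast
    ultimately show "h = h'" using that eq by (auto simp: H_def dest: inj_onD)
  qed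
  have card_H: "real (card (H (u h))) \<le> 32 * (real n * s / R)" if "h \<in> J" for h
  proof -
    define N where "N = {i. i < n \<and> near_route s \<omega> i (u h)}"
    \<comment> \<open>Positions at which route i may transmit from the cell in question: only two
      nodes are eligible, and each occurs at most once.\<close>
    define Q where "Q i = {j. j < nhops (rt i) \<and> rt i ! j \<in> {i, rel (u h)}}" for i
    have "H (u h) \<subseteq> (SIGMA i:N. Q i)"
      using rt(3,4) by (fastforce simp: H_def J_def N_def Q_def u_def)
    then have "card (H (u h)) \<le> card (SIGMA i:N. Q i)"
      by (intro card_mono) (auto simp: N_def Q_def)
    also have "\<dots> = (\<Sum>i\<in>N. card (Q i))"
      by (intro card_SigmaI) (auto simp: N_def Q_def)
    also have "\<dots> \<le> (\<Sum>i\<in>N. 2)"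
    proof (rule sum_mono)
      fix i assume "i \<in> N"
      then have "distinct (rt i)" using rt(1) by (auto simp: N_def valid_route_def)
      then have "inj_on (\<lambda>j. rt i ! j) (Q i)"
        by (intro inj_onI, elim iffD1[OF nth_eq_iff_index_eq, rotated 3]) (auto simp: Q_def nhops_def)
      then have "card (Q i) \<le> card {i, rel (u h)}"
        by (rule card_inj_on_le) (auto simp: Q_def)
      also have "\<dots> \<le> 2" by (simp add: card_insert_if)
      finally show "card (Q i) \<le> 2" .
    qed
    finally have "card (H (u h)) \<le> 2 * card N" by simp
    moreover have "real (card N) \<le> 16 * (real n * s / R)"
      unfolding N_def u_def using that node disk
      by (intro card_near_route_le[OF good s0]) (auto simp: J_def)
    ultimately show ?thesis by linarith
  qed
  have slot_le: "real (slot h) \<le> 32 * (real M)\<^sup>2 * (real n * s / R)" if "h \<in> J" for h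
  proof -
    have "f (u h) h \<in> {0..<card (H (u h))}"
      using that by (intro bij_betw_apply[OF f]) (simp add: H_def)
    then have "slot h \<le> M\<^sup>2 * Suc (f (u h) h)" "Suc (f (u h) h) \<le> card (H (u h))"
      using colour_less[of "u h"] by (auto simp: slot_def)
    then have "slot h \<le> M\<^sup>2 * card (H (u h))" by (meson mult_le_mono2 order_trans)
    then have "real (slot h) \<le> (real M)\<^sup>2 * real (card (H (u h)))"
      by (metis of_nat_le_iff of_nat_mult of_nat_power)
    also have "\<dots> \<le> (real M)\<^sup>2 * (32 * (real n * s / R))"
      using card_H[OF that] by (intro mult_left_mono) auto
    finally show ?thesis by (simp only: mult_ac)
  qed
  define S :: system where "S = (rt, \<lambda>i j. slot (i, j))"
  have "is_system n \<omega> S"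
    unfolding is_system_def
  proof (intro conjI allI impI)
    fix i i' j j'
    assume *: "i < n" "i' < n" "j < nhops (fst S i)" "j' < nhops (fst S i')"
      "(i, j) \<noteq> (i', j') \<and> fst S i ! j = fst S i' ! j'"
    \<comment> \<open>A node lies in a single cell, and hops from one cell have distinct slots, so
      compatibility follows from the cell-wise schedule.\<close>
    then have "u (i, j) = u (i', j')" by (simp add: u_def S_def)
    then show "snd S i j \<noteq> snd S i' j'"
      using slot_eq(2)[of "(i, j)" "(i', j')"] * by (auto simp: J_def S_def)
  qed (use rt(1) in \<open>auto simp: S_def slot_def\<close>)
  moreover have "SINR_successful \<alpha> \<beta> No P n \<omega> S"
    unfolding SINR_successful_def
  proof (intro ballI, clarify)
    fix k t r assume "(t, r) \<in> hop_set n S k"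
    then obtain i j where ij: "(i, j) \<in> J" "slot (i, j) = k" "t = rt i ! j" "r = rt i ! Suc j"
      by (auto simp: hop_set_def S_def J_def)
    define T where "T = loc \<omega> ` transmitters n S k - {loc \<omega> t}"
    have tx: "\<exists>h\<in>J. slot h = k \<and> t' = loc \<omega> (rt (fst h) ! snd h)" if "t' \<in> T" for t'
      using that by (force simp: T_def transmitters_def hop_set_def S_def J_def)
    have "T \<subseteq> (\<lambda>h. loc \<omega> (rt (fst h) ! snd h)) ` J" using tx by blast
    then have "finite T" using finJ finite_surj by blast
    moreover have "inj_on (cell s) T"
    proof (rule inj_onI)
      fix x y assume "x \<in> T" "y \<in> T" "cell s x = cell s y"
      then show "x = y" using tx[of x] tx[of y] slot_eq(2) by (auto simp: u_def) metis
    qed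
    moreover have "cell s t' \<noteq> cell s (loc \<omega> t) \<and> int M dvd fst (cell s t') - fst (cell s (loc \<omega> t)) \<and>
        int M dvd snd (cell s t') - snd (cell s (loc \<omega> t))" if t': "t' \<in> T" for t'
    proof -
      obtain h where h: "h \<in> J" "slot h = k" "t' = loc \<omega> (rt (fst h) ! snd h)" using tx[OF t'] by blast
      \<comment> \<open>T excludes the location of t, so an interferer belongs to another hop;
        sharing the slot, it must have the same colour but a different cell.\<close>
      have "h \<noteq> (i, j)" using h(3) ij(3) t' by (auto simp: T_def)
      then have "u h \<noteq> u (i, j)" using slot_eq(2)[OF h(1) ij(1)] h(2) ij(2) by auto
      moreover have "colour (u h) = colour (u (i, j))" using slot_eq(1)[OF h(1) ij(1)] h(2) ij(2) by simp
      ultimately show ?thesis using colour_eq[of "u h" "u (i, j)"] by (simp add: u_def h(3) ij(3))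
    qed
    moreover have "dist (loc \<omega> t) (loc \<omega> r) \<le> 3 * s"
      using rt(2) ij by (auto simp: J_def)
    ultimately show "SINR_ok \<alpha> \<beta> No P (loc \<omega> t) (loc \<omega> r) (loc \<omega> ` transmitters n S k - {loc \<omega> t})"
      unfolding T_def[symmetric]
      by (intro M(2)[unfolded separated_SINR_def, rule_format, OF No s P]) auto
  qed
  moreover have "0 < period n S \<and> real (period n S) \<le> 32 * (real M)\<^sup>2 * (real n * s / R)"
  proof -
    have slots: "{snd S i j | i j. i < n \<and> j < nhops (fst S i)} = slot ` J"
      by (auto simp: S_def J_def image_iff)
    \<comment> \<open>The maximum defining the period is over a nonempty set, so it is attained by
      some hop.\<close>
    have "(0, 0) \<in> J" using n rt(1)[of 0] by (auto simp: J_def valid_route_def nhops_def)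
    then have "period n S \<in> slot ` J"
      unfolding period_def slots using finJ by (intro Max_in) auto
    then show ?thesis using slot_le by (auto simp: slot_def)
  qed
  ultimately show ?thesis by blast
qed

subsection \<open>Tail bounds and disk probabilities\<close>

text \<open>The excess correlation q / (n - 1) is that of two sources drawing the same destination.\<close>

lemma (in prob_space) correlated_events_count_tail:
  fixes B :: "nat \<Rightarrow> 'a set" and q t :: real
  assumes B: "\<And>i. i < n \<Longrightarrow> B i \<in> events" and n: "2 \<le> n" and t: "0 < t"
    and q: "\<And>i. i < n \<Longrightarrow> prob (B i) = q"
    and pair: "\<And>i k. i < n \<Longrightarrow> k < n \<Longrightarrow> i \<noteq> k \<Longrightarrow> prob (B i \<inter> B k) \<le> q\<^sup>2 + q / (real n - 1)"
  shows "{x \<in> space M. real n * q + t \<le> real (card {i. i < n \<and> x \<in> B i})} \<in> events"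
    and "prob {x \<in> space M. real n * q + t \<le> real (card {i. i < n \<and> x \<in> B i})} \<le> 3 * real n * q / t\<^sup>2"
proof -
  define X :: "'a \<Rightarrow> real" where "X x = (\<Sum>i<n. indicator (B i) x)" for x
  have X_card: "X x = real (card {i. i < n \<and> x \<in> B i})" for x
  proof -
    have "X x = (\<Sum>i<n. if x \<in> B i then 1 else 0)" by (simp add: X_def indicator_def of_bool_def)
    also have "\<dots> = real (card ({..<n} \<inter> {i. x \<in> B i}))" by (simp add: sum.If_cases)
    also have "{..<n} \<inter> {i. x \<in> B i} = {i. i < n \<and> x \<in> B i}" by auto
    finally show ?thesis .
  qed
  have [measurable]: "X \<in> borel_measurable M"
    unfolding X_def using B by (intro borel_measurable_sum borel_measurable_indicator) auto
  have q0: "0 \<le> q" using q[of 0] n measure_nonneg[of M "B 0"] by simp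
  have EX: "expectation X = real n * q"
  proof -
    have "expectation X = (\<Sum>i<n. expectation (indicator (B i)))"
      unfolding X_def using B by (intro Bochner_Integration.integral_sum integrable_real_indicator)
        (auto simp: emeasure_eq_measure)
    also have "\<dots> = (\<Sum>i<n. q)" using B q by (intro sum.cong) auto
    finally show ?thesis by simp
  qed
  have X2: "(X x)\<^sup>2 = (\<Sum>i<n. \<Sum>k<n. indicator (B i \<inter> B k) x)" for x
    by (simp add: X_def power2_eq_square sum_product indicator_inter_arith)
  have int2: "integrable M (\<lambda>x. (X x)\<^sup>2)"
    unfolding X2 using B by (intro Bochner_Integration.integrable_sum) (auto intro!: integrable_real_indicator simp: emeasure_eq_measure)
  have int1: "integrable M X"
    unfolding X_def using B by (intro Bochner_Integration.integrable_sum) (auto intro!: integrable_real_indicator simp: emeasure_eq_measure)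
  have "expectation (\<lambda>x. (X x)\<^sup>2) = (\<Sum>i<n. \<Sum>k<n. prob (B i \<inter> B k))"
  proof -
    have ind: "integrable M (indicator (B i \<inter> B k) :: 'a \<Rightarrow> real)" if "i < n" "k < n" for i k
      using B that by (intro integrable_real_indicator) (auto simp: emeasure_eq_measure)
    have "expectation (\<lambda>x. (X x)\<^sup>2) = (\<Sum>i<n. expectation (\<lambda>x. \<Sum>k<n. indicator (B i \<inter> B k) x))"
      unfolding X2 using ind by (intro Bochner_Integration.integral_sum Bochner_Integration.integrable_sum) auto
    also have "\<dots> = (\<Sum>i<n. \<Sum>k<n. expectation (indicator (B i \<inter> B k)))"
      using ind by (intro sum.cong refl Bochner_Integration.integral_sum) auto
    also have "\<dots> = (\<Sum>i<n. \<Sum>k<n. prob (B i \<inter> B k))"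
      using B by (intro sum.cong refl) (simp add: sets.Int)
    finally show ?thesis .
  qed
  also have "\<dots> \<le> (\<Sum>i<n. \<Sum>k<n. (q\<^sup>2 + q / (real n - 1)) + (if i = k then q else 0))"
  proof (intro sum_mono)
    fix i k assume "i \<in> {..<n}" "k \<in> {..<n}"
    then show "prob (B i \<inter> B k) \<le> (q\<^sup>2 + q / (real n - 1)) + (if i = k then q else 0)"
      using pair[of i k] q[of i] q0 n by auto
  qed
  also have "\<dots> = (real n)\<^sup>2 * (q\<^sup>2 + q / (real n - 1)) + real n * q"
    by (simp add: sum.distrib power2_eq_square distrib_left)
  finally have "variance X \<le> (real n)\<^sup>2 * q / (real n - 1) + real n * q"
    by (subst variance_eq[OF int1 int2]) (simp add: EX power_mult_distrib algebra_simps)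
  \<comment> \<open>As n >= 2, n/(n - 1) <= 2: the excess correlation adds at most 2 n q to the
    diagonal contribution n q, and the variance stays linear in the mean.\<close>
  also have "(real n)\<^sup>2 * q / (real n - 1) \<le> 2 * real n * q"
  proof -
    have "(real n)\<^sup>2 \<le> 2 * real n * (real n - 1)" using n by (simp add: power2_eq_square algebra_simps)
    then have "(real n)\<^sup>2 * q \<le> 2 * real n * (real n - 1) * q" using q0 by (intro mult_right_mono)
    then show ?thesis using n by (simp add: pos_divide_le_eq algebra_simps)
  qed
  finally have var: "variance X \<le> 3 * real n * q" by (simp add: mult_ac)
  let ?E = "{x \<in> space M. real n * q + t \<le> real (card {i. i < n \<and> x \<in> B i})}"
  have E_eq: "?E = {x \<in> space M. real n * q + t \<le> X x}" by (simp only: X_card)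
  show "?E \<in> events" unfolding E_eq by measurable
  have "prob ?E \<le> prob {x \<in> space M. t \<le> \<bar>X x - expectation X\<bar>}"
    unfolding E_eq EX by (intro finite_measure_mono subsetI) auto
  also have "\<dots> \<le> variance X / t\<^sup>2"
    using int2 t by (intro Chebyshev_inequality) auto
  also have "\<dots> \<le> 3 * real n * q / t\<^sup>2" using var by (intro divide_right_mono) auto
  finally show "prob ?E \<le> 3 * real n * q / t\<^sup>2" .
qed

section \<open>Areas of balls and strips in the disk\<close>

abbreviation node_measure :: "real \<Rightarrow> nat \<Rightarrow> nat \<Rightarrow> ((real^2) \<times> nat) measure" where
  "node_measure R n i \<equiv> uniform_measure lborel (cball 0 R) \<Otimes>\<^sub>M uniform_measure (count_space UNIV) ({..<n} - {i})"

definition disk_prob :: "real \<Rightarrow> (real^2) set \<Rightarrow> real" where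
  "disk_prob R A = measure (uniform_measure lborel (cball 0 R)) A"

lemma prob_space_disk: "0 < R \<Longrightarrow> prob_space (uniform_measure lborel (cball (0 :: real^2) R))"
  by (intro prob_space_uniform_measure) (auto simp: emeasure_cball unit_ball_vol_2)

lemma prob_space_dest: "2 \<le> n \<Longrightarrow> prob_space (uniform_measure (count_space UNIV) ({..<n} - {i :: nat}))"
proof -
  assume n: "2 \<le> n"
  have "{..<n} - {i} \<noteq> {}" using n by (auto simp: subset_singleton_iff lessThan_empty_iff dest!: arg_cong[where f = card])
  then show ?thesis
    by (intro prob_space_uniform_measure) (auto simp: emeasure_count_space_eq_0)
qed

lemma content_disk_2: "0 \<le> r \<Longrightarrow> measure lborel (cball (c :: real^2) r) = pi * r\<^sup>2"
  by (simp add: content_cball unit_ball_vol_2)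

lemma disk_prob_eq:
  assumes "0 < R" "A \<in> sets borel"
  shows "disk_prob R A = measure lborel (cball 0 R \<inter> A) / (pi * R\<^sup>2)"
  unfolding disk_prob_def using assms
  by (subst measure_uniform_measure) (auto simp: emeasure_cball content_disk_2 unit_ball_vol_2)

lemma disk_prob_cball:
  assumes "0 < R" "0 \<le> r" "cball c r \<subseteq> cball 0 R"
  shows "disk_prob R (cball c r) = (r / R)\<^sup>2"
proof -
  have "cball 0 R \<inter> cball c r = cball c r" using assms by auto
  then show ?thesis using assms by (simp add: disk_prob_eq content_disk_2 power_divide)
qed

text \<open>The strip meets the disk inside a box of sides 2 s and 2 R. Dividing by pi R^2 gives 4 s
  / (pi R), and pi >= 2 suffices.\<close>

lemma disk_prob_strip_le:
  assumes R: "0 < R" and s: "0 < s"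
  shows "disk_prob R {x. \<bar>x $ k / s - p\<bar> \<le> 1} \<le> 2 * s / R"
proof -
  define A :: "(real^2) set" where "A = {x. \<bar>x $ k / s - p\<bar> \<le> 1}"
  have A: "A \<in> sets borel" unfolding A_def by measurable
  define lo up :: "real^2" where "lo = (\<chi> l. if l = k then s * (p - 1) else - R)"
    and "up = (\<chi> l. if l = k then s * (p + 1) else R)"
  have sub: "cball 0 R \<inter> A \<subseteq> cbox lo up"
  proof
    fix x assume x: "x \<in> cball 0 R \<inter> A"
    then have "\<bar>x $ l\<bar> \<le> R" for l using component_le_norm_cart[of x l] by (simp add: dist_norm)
    then have "- R \<le> x $ l" "x $ l \<le> R" for l by (simp_all add: abs_le_iff minus_le_iff)
    moreover have "s * (p - 1) \<le> x $ k" "x $ k \<le> s * (p + 1)"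
      using x s by (auto simp: A_def abs_le_iff field_simps)
    ultimately show "x \<in> cbox lo up" by (auto simp: mem_box_cart lo_def up_def)
  qed
  have ne: "cbox lo up \<noteq> {}"
    using s R by (auto simp: interval_ne_empty_cart lo_def up_def)
  have "measure lborel (cball 0 R \<inter> A) \<le> measure lborel (cbox lo up)"
    using sub A by (intro measure_mono_fmeasurable) auto
  also have "\<dots> = (\<Prod>l\<in>UNIV. up $ l - lo $ l)" using ne by (simp add: content_cbox_cart)
  also have "\<dots> = (2 * s) * (2 * R)"
    using exhaust_2[of k] by (auto simp: UNIV_2 lo_def up_def algebra_simps)
  finally have "disk_prob R A \<le> (4 * s * R) / (pi * R\<^sup>2)"
    using R by (simp add: disk_prob_eq A divide_right_mono)
  also have "\<dots> = 4 / pi * (s / R)" using R by (simp add: field_simps power2_eq_square)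
  also have "\<dots> \<le> 2 * (s / R)"
    using pi_ge_two s R by (intro mult_right_mono) (auto simp: field_simps)
  finally show ?thesis by (simp add: A_def)
qed

subsection \<open>The random configuration\<close>

definition config_measure :: "real \<Rightarrow> nat \<Rightarrow> config measure" where
  "config_measure R n = PiM {..<n} (node_measure R n)"

lemma sd_measure_eq: "sd_measure \<gamma> n = config_measure (real n powr \<gamma>) n"
  unfolding sd_measure_def config_measure_def by (rule refl)

locale random_network =
  fixes R :: real and n :: nat
  assumes R: "0 < R" and n: "2 \<le> n"
begin

lemma prob_space_node: "prob_space (node_measure R n i)"
  by (intro prob_space_pair prob_space_disk prob_space_dest R n)

sublocale prob_space "config_measure R n"
  unfolding config_measure_def by (rule prob_space_PiM, rule prob_space_node)

section \<open>Joint laws of locations and destinations\<close>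

lemma measure_dest:
  "measure (uniform_measure (count_space UNIV) ({..<n} - {i})) D = real (card (({..<n} - {i}) \<inter> D)) / real (card ({..<n} - {i}))"
proof -
  have "{..<n} - {i} \<noteq> {}" using n by (auto simp: subset_singleton_iff lessThan_empty_iff dest!: arg_cong[where f = card])
  then show ?thesis
    by (subst measure_uniform_measure) (auto simp: emeasure_count_space_eq_0 measure_count_space)
qed

lemma measure_node_Times:
  assumes "A \<in> sets borel"
  shows "measure (node_measure R n i) (A \<times> D)
    = disk_prob R A * measure (uniform_measure (count_space UNIV) ({..<n} - {i})) D"
proof -
  interpret dest: prob_space "uniform_measure (count_space UNIV) ({..<n} - {i})"
    by (rule prob_space_dest[OF n])
  show ?thesis
    using assms unfolding disk_prob_def measure_def
    by (subst dest.emeasure_pair_measure_Times) (auto simp: enn2real_mult)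
qed

lemma config_box:
  assumes "\<And>i. i < n \<Longrightarrow> A i \<in> sets borel"
  shows "{\<omega> \<in> space (config_measure R n). \<forall>i<n. loc \<omega> i \<in> A i \<and> dest \<omega> i \<in> D i} \<in> events" (is "?E \<in> _")
    and "prob {\<omega> \<in> space (config_measure R n). \<forall>i<n. loc \<omega> i \<in> A i \<and> dest \<omega> i \<in> D i}
      = (\<Prod>i<n. disk_prob R (A i) * measure (uniform_measure (count_space UNIV) ({..<n} - {i})) (D i))"
proof -
  interpret node: prob_space "node_measure R n i" for i by (rule prob_space_node)
  interpret PM: product_prob_space "node_measure R n" "{..<n}" by unfold_locales
  have E: "?E = {\<omega> \<in> space (config_measure R n). \<forall>i\<in>{..<n}. \<omega> i \<in> A i \<times> D i}"
    by (auto simp: loc_def dest_def mem_Times_iff)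
  have AD: "A i \<times> D i \<in> sets (node_measure R n i)" if "i < n" for i
    using assms[OF that] by (intro pair_measureI) auto
  show "?E \<in> events"
    unfolding E unfolding config_measure_def using AD
    by (intro sets.sets_Collect_finite_All sets_Collect_single) auto
  have "emeasure (config_measure R n) ?E = (\<Prod>i<n. emeasure (node_measure R n i) (A i \<times> D i))"
    unfolding E unfolding config_measure_def using AD by (intro PM.emeasure_PiM_Collect) auto
  also have "\<dots> = (\<Prod>i<n. ennreal (measure (node_measure R n i) (A i \<times> D i)))"
    by (intro prod.cong refl finite_measure.emeasure_eq_measure prob_space.finite_measure prob_space_node)
  finally have "prob ?E = (\<Prod>i<n. measure (node_measure R n i) (A i \<times> D i))"
    by (simp add: measure_def prod_ennreal prod_nonneg)
  then show "prob ?E = (\<Prod>i<n. disk_prob R (A i) * measure (uniform_measure (count_space UNIV) ({..<n} - {i})) (D i))"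
    using assms by (simp add: measure_node_Times)
qed

lemma disk_prob_UNIV: "disk_prob R UNIV = 1"
  using prob_space.prob_space[OF prob_space_disk[OF R]]
  unfolding disk_prob_def space_uniform_measure space_lborel by (simp only: space_borel)

lemma disk_prob_Compl:
  assumes "A \<in> sets borel"
  shows "disk_prob R (- A) = 1 - disk_prob R A"
  using prob_space.prob_compl[OF prob_space_disk[OF R], of A] assms
  by (simp only: disk_prob_def Compl_eq_Diff_UNIV space_uniform_measure sets_uniform_measure
      space_lborel sets_lborel space_borel)

text \<open>Nodes are independent, as are location and destination of one node, so each prescribed
  location or destination contributes one factor. The second-moment computations use it with at most
  two nodes on either side.\<close>

lemma prob_locations_dests:
  assumes A: "A \<in> sets borel" and J: "J \<subseteq> {..<n}" and I: "I \<subseteq> {..<n}"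
    and g: "\<And>i. i \<in> I \<Longrightarrow> g i < n \<and> g i \<noteq> i"
  shows "{\<omega> \<in> space (config_measure R n). (\<forall>j\<in>J. loc \<omega> j \<in> A) \<and> (\<forall>i\<in>I. dest \<omega> i = g i)} \<in> events" (is "?E \<in> _")
    and "prob {\<omega> \<in> space (config_measure R n). (\<forall>j\<in>J. loc \<omega> j \<in> A) \<and> (\<forall>i\<in>I. dest \<omega> i = g i)}
      = disk_prob R A ^ card J * (1 / (real n - 1)) ^ card I"
proof -
  define A' where "A' i = (if i \<in> J then A else UNIV)" for i
  define D where "D i = (if i \<in> I then {g i} else UNIV)" for i
  have A': "A' i \<in> sets borel" for i using A by (simp add: A'_def)
  have E: "?E = {\<omega> \<in> space (config_measure R n). \<forall>i<n. loc \<omega> i \<in> A' i \<and> dest \<omega> i \<in> D i}"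
    using I J by (fastforce simp: A'_def D_def)
  show "?E \<in> events" unfolding E by (rule config_box(1)[OF A'])
  have restrict: "(\<Prod>i<n. if i \<in> K then a else 1) = a ^ card K" if "K \<subseteq> {..<n}" for K and a :: real
    using that by (simp add: prod.If_cases Int_absorb1 inf.absorb2)
  have "measure (uniform_measure (count_space UNIV) ({..<n} - {i})) (D i)
      = (if i \<in> I then 1 / (real n - 1) else 1)" if "i < n" for i
  proof (cases "i \<in> I")
    case True
    then have "({..<n} - {i}) \<inter> D i = {g i}" using g by (auto simp: D_def)
    then show ?thesis using True that n by (simp add: measure_dest of_nat_diff)
  next
    case False
    then show ?thesis using that n by (simp add: measure_dest D_def)
  qed
  moreover have "disk_prob R (A' i) = (if i \<in> J then disk_prob R A else 1)" for i
    by (simp add: A'_def disk_prob_UNIV)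
  ultimately have "prob ?E = (\<Prod>i<n. (if i \<in> J then disk_prob R A else 1) * (if i \<in> I then 1 / (real n - 1) else 1))"
    unfolding E config_box(2)[OF A'] by (intro prod.cong) auto
  then show "prob ?E = disk_prob R A ^ card J * (1 / (real n - 1)) ^ card I"
    by (simp add: prod.distrib restrict[OF I] restrict[OF J] del: power_one_over)
qed

lemma prob_all_locations_in:
  assumes "A \<in> sets borel"
  shows "{\<omega> \<in> space (config_measure R n). \<forall>i<n. loc \<omega> i \<in> A} \<in> events" (is "?E \<in> _")
    and "prob {\<omega> \<in> space (config_measure R n). \<forall>i<n. loc \<omega> i \<in> A} = disk_prob R A ^ n"
proof -
  have "?E = {\<omega> \<in> space (config_measure R n). (\<forall>j\<in>{..<n}. loc \<omega> j \<in> A) \<and> (\<forall>i\<in>{}. dest \<omega> i = id i)}"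
    by auto
  then show "?E \<in> events" "prob ?E = disk_prob R A ^ n"
    using prob_locations_dests[OF assms, of "{..<n}" "{}" id] by auto
qed

lemma prob_well_formed_in_disk:
  shows "{\<omega> \<in> space (config_measure R n). well_formed_sd n \<omega> \<and> (\<forall>i<n. norm (loc \<omega> i) \<le> R)} \<in> events" (is "?E \<in> _")
    and "prob {\<omega> \<in> space (config_measure R n). well_formed_sd n \<omega> \<and> (\<forall>i<n. norm (loc \<omega> i) \<le> R)} = 1"
proof -
  have E: "?E = {\<omega> \<in> space (config_measure R n). \<forall>i<n. loc \<omega> i \<in> cball 0 R \<and> dest \<omega> i \<in> {..<n} - {i}}"
    by (auto simp: well_formed_sd_def)
  show "?E \<in> events" unfolding E by (rule config_box) simp
  have "disk_prob R (cball 0 R) = 1"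
    using disk_prob_cball[OF R, of R 0] R by simp
  moreover have "measure (uniform_measure (count_space UNIV) ({..<n} - {i})) ({..<n} - {i}) = 1" if "i < n" for i
    using that n by (simp add: measure_dest)
  ultimately show "prob ?E = 1"
    unfolding E by (subst config_box) auto
qed

lemma source_count_tail:
  assumes A: "A \<in> sets borel" and t: "0 < t"
  shows "{\<omega> \<in> space (config_measure R n). real n * disk_prob R A + t \<le> real (card {i. i < n \<and> loc \<omega> i \<in> A})} \<in> events" (is "?E \<in> _")
    and "prob {\<omega> \<in> space (config_measure R n). real n * disk_prob R A + t \<le> real (card {i. i < n \<and> loc \<omega> i \<in> A})}
      \<le> 3 * real n * disk_prob R A / t\<^sup>2"
proof -
  define B where "B i = {\<omega> \<in> space (config_measure R n). loc \<omega> i \<in> A}" for i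
  have q0: "0 \<le> disk_prob R A" by (simp add: disk_prob_def)
  have B: "B i \<in> events" "prob (B i) = disk_prob R A" if "i < n" for i
    unfolding B_def using prob_locations_dests[OF A, of "{i}" "{}"] that by simp_all
  have pair: "prob (B i \<inter> B k) \<le> (disk_prob R A)\<^sup>2 + disk_prob R A / (real n - 1)" if "i < n" "k < n" "i \<noteq> k" for i k
  proof -
    have "B i \<inter> B k = {\<omega> \<in> space (config_measure R n). loc \<omega> i \<in> A \<and> loc \<omega> k \<in> A}"
      by (auto simp: B_def)
    then have "prob (B i \<inter> B k) = (disk_prob R A)\<^sup>2"
      using prob_locations_dests(2)[OF A, of "{i, k}" "{}"] that by (simp add: power2_eq_square)
    then show ?thesis using q0 n by simp
  qed
  have E: "?E = {\<omega> \<in> space (config_measure R n). real n * disk_prob R A + t \<le> real (card {i. i < n \<and> \<omega> \<in> B i})}"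
    by (auto simp: B_def)
  show "?E \<in> events" "prob ?E \<le> 3 * real n * disk_prob R A / t\<^sup>2"
    unfolding E by (rule correlated_events_count_tail[OF B(1) n t B(2) pair]; assumption)+
qed

text \<open>The destination index is itself random, so the event is split over its values j. For
  sources i and k with destinations j and l, different j and l give q^2, while j = l leaves only one
  location to constrain and gives q; there are at most n - 1 such coincidences, each of weight 1/(n
  - 1)^2. Well-formedness identifies the count with that of the events \<open>B i\<close>.\<close>

lemma dest_count_tail:
  assumes A: "A \<in> sets borel" and t: "0 < t"
  obtains E where "E \<in> events" "prob E \<le> 3 * real n * disk_prob R A / t\<^sup>2"
    "\<And>\<omega>. \<omega> \<in> space (config_measure R n) \<Longrightarrow> \<omega> \<notin> E \<Longrightarrow> well_formed_sd n \<omega> \<Longrightarrow>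
      real (card {i. i < n \<and> loc \<omega> (dest \<omega> i) \<in> A}) \<le> real n * disk_prob R A + t"
proof -
  define q where "q = disk_prob R A"
  define C where "C i j = {\<omega> \<in> space (config_measure R n). dest \<omega> i = j \<and> loc \<omega> j \<in> A}" for i j
  define B where "B i = (\<Union>j\<in>{..<n} - {i}. C i j)" for i
  have q0: "0 \<le> q" by (simp add: q_def disk_prob_def)
  have C: "C i j \<in> events" "prob (C i j) = q / (real n - 1)" if "i < n" "j \<in> {..<n} - {i}" for i j
    using prob_locations_dests[OF A, of "{j}" "{i}" "\<lambda>_. j"] that by (simp_all add: C_def q_def conj_commute)
  have B: "B i \<in> events" if "i < n" for i
    unfolding B_def using C that by auto
  have Bq: "prob (B i) = q" if "i < n" for i
  proof -
    have "prob (B i) = (\<Sum>j\<in>{..<n} - {i}. prob (C i j))"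
      unfolding B_def using C that
      by (intro finite_measure_finite_Union) (auto simp: disjoint_family_on_def C_def)
    also have "\<dots> = (\<Sum>j\<in>{..<n} - {i}. q / (real n - 1))" using C that by (intro sum.cong) auto
    also have "\<dots> = q" using that n by (simp add: of_nat_diff)
    finally show ?thesis .
  qed
  have pair: "prob (B i \<inter> B k) \<le> q\<^sup>2 + q / (real n - 1)" if ik: "i < n" "k < n" "i \<noteq> k" for i k
  proof -
    have CC: "C i j \<inter> C k l \<in> events" "prob (C i j \<inter> C k l) \<le> (q\<^sup>2 + (if j = l then q else 0)) / (real n - 1)\<^sup>2"
      if "j \<in> {..<n} - {i}" "l \<in> {..<n} - {k}" for j l
    proof -
      have eq: "C i j \<inter> C k l = {\<omega> \<in> space (config_measure R n). (\<forall>m\<in>{j, l}. loc \<omega> m \<in> A) \<and>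
          (\<forall>m\<in>{i, k}. dest \<omega> m = (if m = i then j else l))}"
        using ik(3) by (auto simp: C_def)
      have "prob (C i j \<inter> C k l) = q ^ card {j, l} * (1 / (real n - 1)) ^ card {i, k}"
        unfolding eq q_def using that ik by (intro prob_locations_dests(2)[OF A]) auto
      \<comment> \<open>For j = l the set {j, l} is a singleton, so the location factor is q instead
        of q^2.\<close>
      also have "\<dots> \<le> (q\<^sup>2 + (if j = l then q else 0)) / (real n - 1)\<^sup>2"
        using ik(3) q0 by (auto simp: power2_eq_square divide_simps)
      finally show "prob (C i j \<inter> C k l) \<le> (q\<^sup>2 + (if j = l then q else 0)) / (real n - 1)\<^sup>2" .
      show "C i j \<inter> C k l \<in> events" using C that ik by auto
    qed
    have "B i \<inter> B k = (\<Union>(j, l)\<in>({..<n} - {i}) \<times> ({..<n} - {k}). C i j \<inter> C k l)"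
      by (auto simp: B_def)
    then have "prob (B i \<inter> B k) \<le> (\<Sum>(j, l)\<in>({..<n} - {i}) \<times> ({..<n} - {k}). prob (C i j \<inter> C k l))"
      using CC(1) by (simp add: case_prod_unfold) (intro finite_measure_subadditive_finite, auto)
    also have "\<dots> = (\<Sum>j\<in>{..<n} - {i}. \<Sum>l\<in>{..<n} - {k}. prob (C i j \<inter> C k l))"
      by (simp add: sum.cartesian_product)
    also have "\<dots> \<le> (\<Sum>j\<in>{..<n} - {i}. \<Sum>l\<in>{..<n} - {k}. (q\<^sup>2 + (if j = l then q else 0)) / (real n - 1)\<^sup>2)"
      using CC(2) by (intro sum_mono) auto
    also have "\<dots> = (\<Sum>j\<in>{..<n} - {i}. ((real n - 1) * q\<^sup>2 + (\<Sum>l\<in>{..<n} - {k}. if j = l then q else 0)) / (real n - 1)\<^sup>2)"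
      using ik n by (simp add: sum.distrib of_nat_diff flip: sum_divide_distrib)
    also have "\<dots> \<le> (\<Sum>j\<in>{..<n} - {i}. ((real n - 1) * q\<^sup>2 + q) / (real n - 1)\<^sup>2)"
      using q0 by (intro sum_mono divide_right_mono add_left_mono) auto
    also have "\<dots> = (real n - 1) * (((real n - 1) * q\<^sup>2 + q) / (real n - 1)\<^sup>2)"
      using ik n by (simp add: of_nat_diff)
    also have "\<dots> = q\<^sup>2 + q / (real n - 1)"
    proof -
      have "m * ((m * a + q) / m\<^sup>2) = a + q / m" if "m \<noteq> 0" for m a :: real
        using that by (simp add: add_divide_distrib distrib_left power2_eq_square)
      then show ?thesis using n by simp
    qed
    finally show ?thesis .
  qed
  define E where "E = {\<omega> \<in> space (config_measure R n). real n * q + t \<le> real (card {i. i < n \<and> \<omega> \<in> B i})}"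
  have "E \<in> events" "prob E \<le> 3 * real n * q / t\<^sup>2"
    unfolding E_def by (rule correlated_events_count_tail[OF B n t Bq pair]; assumption)+
  moreover have "real (card {i. i < n \<and> loc \<omega> (dest \<omega> i) \<in> A}) \<le> real n * q + t"
    if "\<omega> \<in> space (config_measure R n)" "\<omega> \<notin> E" "well_formed_sd n \<omega>" for \<omega>
  proof -
    have "{i. i < n \<and> loc \<omega> (dest \<omega> i) \<in> A} = {i. i < n \<and> \<omega> \<in> B i}"
      using that(1,3) by (auto simp: B_def C_def well_formed_sd_def)
    then show ?thesis using that(1,2) by (simp add: E_def)
  qed
  ultimately show ?thesis using that[of E] by (simp add: q_def)
qed

text \<open>A ball of radius s/6 inside the disk has probability 1/(36 (R/s)^2), and (1 - q)^n <=
  exp (-n q). Its centre is within s/6 of the lattice point, which explains s/3 = s/6 + s/6.\<close>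

lemma prob_lattice_point_isolated_le:
  assumes s: "0 < s" "s \<le> R" and v: "norm (lattice_point s v) \<le> R"
  obtains E where "E \<in> events" "prob E \<le> exp (- (real n / (36 * (R / s)\<^sup>2)))"
    "\<And>\<omega>. \<omega> \<in> space (config_measure R n) \<Longrightarrow> \<omega> \<notin> E \<Longrightarrow>
      \<exists>i<n. dist (loc \<omega> i) (lattice_point s v) \<le> s / 3"
proof -
  \<comment> \<open>The lattice point is moved towards the origin so that the ball of radius s/6 stays in the disk.\<close>
  define c where "c = (1 - s / (6 * R)) *\<^sub>R lattice_point s v"
  define E where "E = {\<omega> \<in> space (config_measure R n). \<forall>i<n. loc \<omega> i \<in> - cball c (s / 6)}"
  have frac: "0 \<le> 1 - s / (6 * R)" using s R by (simp add: field_simps)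
  have sub: "cball c (s / 6) \<subseteq> cball 0 R"
  proof
    fix x assume "x \<in> cball c (s / 6)"
    then have "norm (x - c) \<le> s / 6" by (simp add: dist_norm norm_minus_commute)
    moreover have "norm c \<le> (1 - s / (6 * R)) * R"
      unfolding c_def using frac v by (simp add: mult_left_mono)
    moreover have "(1 - s / (6 * R)) * R = R - s / 6" using R by (simp add: field_simps)
    ultimately show "x \<in> cball 0 R" using norm_triangle_sub[of x c] by simp
  qed
  have cv: "dist c (lattice_point s v) \<le> s / 6"
  proof -
    have "c - lattice_point s v = - (s / (6 * R)) *\<^sub>R lattice_point s v"
      by (simp add: c_def algebra_simps)
    then have "dist c (lattice_point s v) = s / (6 * R) * norm (lattice_point s v)"
      using s R by (simp add: dist_norm)
    also have "\<dots> \<le> s / (6 * R) * R" using v s R by (intro mult_left_mono) auto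
    finally show ?thesis using R by simp
  qed
  have q: "disk_prob R (cball c (s / 6)) = (s / 6 / R)\<^sup>2"
    using s by (intro disk_prob_cball[OF R _ sub]) simp
  have "prob E = (1 - (s / 6 / R)\<^sup>2) ^ n"
    unfolding E_def by (subst prob_all_locations_in(2)) (auto simp: disk_prob_Compl q)
  also have "\<dots> \<le> exp (- (s / 6 / R)\<^sup>2) ^ n"
  proof (rule power_mono)
    show "1 - (s / 6 / R)\<^sup>2 \<le> exp (- (s / 6 / R)\<^sup>2)"
      using exp_ge_add_one_self[of "- (s / 6 / R)\<^sup>2"] by simp
    have "(s / 6 / R)\<^sup>2 \<le> 1\<^sup>2" using s R by (intro power_mono) (auto simp: field_simps)
    then show "0 \<le> 1 - (s / 6 / R)\<^sup>2" by simp
  qed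
  also have "\<dots> = exp (- (real n / (36 * (R / s)\<^sup>2)))"
    using s R by (simp add: power_divide field_simps flip: exp_of_nat_mult)
  finally have "prob E \<le> exp (- (real n / (36 * (R / s)\<^sup>2)))" .
  moreover have "E \<in> events" unfolding E_def by (rule prob_all_locations_in) auto
  moreover have "\<exists>i<n. dist (loc \<omega> i) (lattice_point s v) \<le> s / 3"
    if \<omega>: "\<omega> \<in> space (config_measure R n)" "\<omega> \<notin> E" for \<omega>
  proof -
    obtain i where i: "i < n" "dist c (loc \<omega> i) \<le> s / 6" using \<omega> by (auto simp: E_def)
    then have "dist (loc \<omega> i) (lattice_point s v) \<le> s / 3"
      using cv dist_triangle[of "loc \<omega> i" "lattice_point s v" c] by (simp add: dist_commute)
    then show ?thesis using i by blast
  qed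
  ultimately show ?thesis using that by blast
qed

text \<open>With t = 2 n s / R bounding the mean, a deviation by t still leaves the count within 2
  t. The tail bound becomes 3/t = 3 R / (2 n s), once for sources and once for destinations.\<close>

lemma prob_strip_overloaded_le:
  assumes s: "0 < s"
  obtains E where "E \<in> events" "prob E \<le> 3 * R / (real n * s)"
    "\<And>\<omega>. \<omega> \<in> space (config_measure R n) \<Longrightarrow> \<omega> \<notin> E \<Longrightarrow> well_formed_sd n \<omega> \<Longrightarrow>
      real (card {i. i < n \<and> \<bar>loc \<omega> i $ k / s - p\<bar> \<le> 1}) \<le> 4 * (real n * s / R) \<and>
      real (card {i. i < n \<and> \<bar>loc \<omega> (dest \<omega> i) $ k / s - p\<bar> \<le> 1}) \<le> 4 * (real n * s / R)"
proof -
  define A :: "(real^2) set" where "A = {x. \<bar>x $ k / s - p\<bar> \<le> 1}"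
  define t where "t = real n * (2 * s / R)"
  have A: "A \<in> sets borel" unfolding A_def by measurable
  have t: "0 < t" using s R n by (simp add: t_def)
  have "real n * disk_prob R A \<le> t"
    unfolding t_def A_def using disk_prob_strip_le[OF R s] by (intro mult_left_mono) auto
  then have le_2t: "x \<le> 4 * (real n * s / R)" if "x \<le> real n * disk_prob R A + t" for x
  proof -
    have "4 * (real n * s / R) = t + t" using R by (simp add: t_def field_simps)
    then show ?thesis
      using order_trans[OF that add_right_mono[OF \<open>real n * disk_prob R A \<le> t\<close>]] by simp
  qed
  have "3 * real n * disk_prob R A / t\<^sup>2 \<le> 3 * t / t\<^sup>2"
    using \<open>real n * disk_prob R A \<le> t\<close> by (intro divide_right_mono) auto
  also have "\<dots> = 3 * R / (2 * real n * s)"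
    using s R n by (simp add: t_def power2_eq_square field_simps)
  finally have tail: "3 * real n * disk_prob R A / t\<^sup>2 \<le> 3 * R / (2 * real n * s)" .
  define E1 where "E1 = {\<omega> \<in> space (config_measure R n).
    real n * disk_prob R A + t \<le> real (card {i. i < n \<and> loc \<omega> i \<in> A})}"
  have E1: "E1 \<in> events" "prob E1 \<le> 3 * real n * disk_prob R A / t\<^sup>2"
    unfolding E1_def by (rule source_count_tail[OF A t])+
  obtain E2 where E2: "E2 \<in> events" "prob E2 \<le> 3 * real n * disk_prob R A / t\<^sup>2"
    "\<And>\<omega>. \<omega> \<in> space (config_measure R n) \<Longrightarrow> \<omega> \<notin> E2 \<Longrightarrow> well_formed_sd n \<omega> \<Longrightarrow>
      real (card {i. i < n \<and> loc \<omega> (dest \<omega> i) \<in> A}) \<le> real n * disk_prob R A + t"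
    by (rule dest_count_tail[OF A t], rule that) blast+
  show ?thesis
  proof (rule that[of "E1 \<union> E2"])
    show "E1 \<union> E2 \<in> events" using E1 E2 by auto
    have "prob (E1 \<union> E2) \<le> prob E1 + prob E2"
      by (rule measure_Un_le[OF E1(1) E2(1)])
    also have "\<dots> \<le> 3 * R / (2 * real n * s) + 3 * R / (2 * real n * s)"
      using E1(2) E2(2) tail by (intro add_mono) linarith+
    finally show "prob (E1 \<union> E2) \<le> 3 * R / (real n * s)" by (simp add: mult.commute)
  next
    fix \<omega> assume \<omega>: "\<omega> \<in> space (config_measure R n)" "\<omega> \<notin> E1 \<union> E2" "well_formed_sd n \<omega>"
    have "real (card {i. i < n \<and> loc \<omega> i \<in> A}) \<le> real n * disk_prob R A + t"
      using \<omega> by (simp add: E1_def)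
    moreover have "real (card {i. i < n \<and> loc \<omega> (dest \<omega> i) \<in> A}) \<le> real n * disk_prob R A + t"
      using \<omega> E2(3) by simp
    ultimately show "real (card {i. i < n \<and> \<bar>loc \<omega> i $ k / s - p\<bar> \<le> 1}) \<le> 4 * (real n * s / R) \<and>
      real (card {i. i < n \<and> \<bar>loc \<omega> (dest \<omega> i) $ k / s - p\<bar> \<le> 1}) \<le> 4 * (real n * s / R)"
      unfolding A_def mem_Collect_eq using le_2t[unfolded A_def] by blast
  qed
qed

text \<open>Union bound over at most 9 (R/s)^2 lattice points and 10 R/s strips. A measurable subset
  is produced instead of the set of good configurations itself, which is all that
  \<open>prob_to_one\<close> asks for.\<close>

lemma prob_good_config_ge:
  assumes s: "0 < s" "s \<le> R"
  obtains A where "A \<in> events" "A \<subseteq> {\<omega> \<in> space (config_measure R n). good_config n s R \<omega>}"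
    "1 - (9 * (R / s)\<^sup>2 * exp (- (real n / (36 * (R / s)\<^sup>2))) + 30 * (R / s)\<^sup>2 / real n) \<le> prob A"
proof -
  define x where "x = R / s"
  have x: "1 \<le> x" using s by (simp add: x_def field_simps)
  \<comment> \<open>K bounds the coordinates of lattice points in the disk and K + 1 the strip
    indices. From x >= 1 follow 2 K + 1 <= 3 x and 2 K + 3 <= 5 x, the origin of the 9 and, over two
    directions, the 10.\<close>
  define K where "K = \<lfloor>x\<rfloor>"
  have K: "1 \<le> K" "of_int K \<le> x" "x < of_int K + 1"
    using x unfolding K_def by (auto simp: le_floor_iff)
  define V where "V = {v \<in> {-K..K} \<times> {-K..K}. norm (lattice_point s v) \<le> R}"
  define I where "I = {-(K + 1)..K + 1}"
  define Z :: "(2 \<times> int) set" where "Z = UNIV \<times> I"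
  have fin: "finite V" "finite Z" by (auto simp: V_def I_def Z_def)
  have inV: "v \<in> V" if "norm (lattice_point s v) \<le> R" for v
  proof -
    have *: "\<bar>a\<bar> \<le> K" if "\<bar>s * of_int a\<bar> \<le> R" for a :: int
    proof -
      have "of_int \<bar>a\<bar> \<le> x" using that s by (simp add: x_def abs_mult field_simps)
      then show ?thesis by (simp add: K_def le_floor_iff)
    qed
    have "\<bar>s * of_int (fst v)\<bar> \<le> R" "\<bar>s * of_int (snd v)\<bar> \<le> R"
      using that component_le_norm_cart[of "lattice_point s v" 1]
        component_le_norm_cart[of "lattice_point s v" 2] by simp_all
    then have "\<bar>fst v\<bar> \<le> K" "\<bar>snd v\<bar> \<le> K" using * by blast+
    then show ?thesis using that by (auto simp: V_def mem_Times_iff abs_le_iff)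
  qed
  have inI: "p \<in> I" if "\<bar>of_int p\<bar> \<le> R / s + 1" for p :: int
  proof -
    have "of_int \<bar>p\<bar> \<le> x + 1" using that by (simp add: x_def)
    then have "\<bar>p\<bar> \<le> K + 1" using K(3) by linarith
    then show ?thesis by (auto simp: I_def abs_le_iff)
  qed
  have cardV: "real (card V) \<le> 9 * x\<^sup>2"
  proof -
    have "card V \<le> card ({-K..K} \<times> {-K..K})" by (intro card_mono) (auto simp: V_def)
    also have "\<dots> = (nat (2 * K + 1))\<^sup>2" by (simp add: card_cartesian_product power2_eq_square)
    finally have "real (card V) \<le> (real (nat (2 * K + 1)))\<^sup>2"
      by (metis of_nat_le_iff of_nat_power)
    also have "\<dots> \<le> (3 * x)\<^sup>2" using K x by (intro power_mono) auto
    finally show ?thesis by (simp add: power_mult_distrib)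
  qed
  have cardI: "real (card I) \<le> 5 * x" using K x by (simp add: I_def)
  have "\<exists>E. \<forall>v\<in>V. E v \<in> events \<and> prob (E v) \<le> exp (- (real n / (36 * x\<^sup>2))) \<and>
      (\<forall>\<omega>\<in>space (config_measure R n). \<omega> \<notin> E v \<longrightarrow> (\<exists>i<n. dist (loc \<omega> i) (lattice_point s v) \<le> s / 3))"
  proof (intro bchoice ballI)
    fix v assume "v \<in> V"
    then have v: "norm (lattice_point s v) \<le> R" by (simp add: V_def)
    show "\<exists>E. E \<in> events \<and> prob E \<le> exp (- (real n / (36 * x\<^sup>2))) \<and>
      (\<forall>\<omega>\<in>space (config_measure R n). \<omega> \<notin> E \<longrightarrow> (\<exists>i<n. dist (loc \<omega> i) (lattice_point s v) \<le> s / 3))"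
      by (rule prob_lattice_point_isolated_le[OF s v]) (auto simp: x_def)
  qed
  then obtain E where E: "\<And>v. v \<in> V \<Longrightarrow> E v \<in> events"
    "\<And>v. v \<in> V \<Longrightarrow> prob (E v) \<le> exp (- (real n / (36 * x\<^sup>2)))"
    "\<And>v \<omega>. v \<in> V \<Longrightarrow> \<omega> \<in> space (config_measure R n) \<Longrightarrow> \<omega> \<notin> E v \<Longrightarrow>
      \<exists>i<n. dist (loc \<omega> i) (lattice_point s v) \<le> s / 3"
    by blast
  define light where "light \<omega> k p \<longleftrightarrow>
    real (card {i. i < n \<and> \<bar>loc \<omega> i $ k / s - p\<bar> \<le> 1}) \<le> 4 * (real n * s / R) \<and>
    real (card {i. i < n \<and> \<bar>loc \<omega> (dest \<omega> i) $ k / s - p\<bar> \<le> 1}) \<le> 4 * (real n * s / R)"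
    for \<omega> :: config and k :: 2 and p :: real
  have "\<exists>F. \<forall>w\<in>Z. F w \<in> events \<and> prob (F w) \<le> 3 * R / (real n * s) \<and>
      (\<forall>\<omega>\<in>space (config_measure R n). \<omega> \<notin> F w \<longrightarrow> well_formed_sd n \<omega> \<longrightarrow>
        light \<omega> (fst w) (of_int (snd w)))"
  proof (intro bchoice ballI)
    fix w :: "2 \<times> int"
    show "\<exists>F. F \<in> events \<and> prob F \<le> 3 * R / (real n * s) \<and>
      (\<forall>\<omega>\<in>space (config_measure R n). \<omega> \<notin> F \<longrightarrow> well_formed_sd n \<omega> \<longrightarrow>
        light \<omega> (fst w) (of_int (snd w)))"
      unfolding light_def
      by (rule prob_strip_overloaded_le[OF s(1), of "fst w" "of_int (snd w)"]) blast
  qed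
  then obtain F where F: "\<And>w. w \<in> Z \<Longrightarrow> F w \<in> events"
    "\<And>w. w \<in> Z \<Longrightarrow> prob (F w) \<le> 3 * R / (real n * s)"
    "\<And>w \<omega>. w \<in> Z \<Longrightarrow> \<omega> \<in> space (config_measure R n) \<Longrightarrow> \<omega> \<notin> F w \<Longrightarrow> well_formed_sd n \<omega> \<Longrightarrow>
      light \<omega> (fst w) (of_int (snd w))"
    by blast
  define G where "G = {\<omega> \<in> space (config_measure R n). well_formed_sd n \<omega> \<and> (\<forall>i<n. norm (loc \<omega> i) \<le> R)}"
  define U1 where "U1 = (\<Union>v\<in>V. E v)"
  define U2 where "U2 = (\<Union>w\<in>Z. F w)"
  have G: "G \<in> events" "prob G = 1" unfolding G_def by (rule prob_well_formed_in_disk)+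
  have U: "U1 \<in> events" "U2 \<in> events"
    unfolding U1_def U2_def using E(1) F(1) fin by (auto intro!: sets.finite_UN)
  have "prob U1 \<le> (\<Sum>v\<in>V. prob (E v))"
    unfolding U1_def using E(1) fin by (intro finite_measure_subadditive_finite) auto
  also have "\<dots> \<le> real (card V) * exp (- (real n / (36 * x\<^sup>2)))"
    using E(2) by (intro sum_bounded_above) auto
  also have "\<dots> \<le> 9 * x\<^sup>2 * exp (- (real n / (36 * x\<^sup>2)))"
    using cardV by (intro mult_right_mono) auto
  finally have P1: "prob U1 \<le> 9 * x\<^sup>2 * exp (- (real n / (36 * x\<^sup>2)))" .
  have "prob U2 \<le> (\<Sum>w\<in>Z. prob (F w))"
    unfolding U2_def using F(1) fin by (intro finite_measure_subadditive_finite) auto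
  also have "\<dots> \<le> real (card Z) * (3 * R / (real n * s))"
    using F(2) by (intro sum_bounded_above) auto
  also have "\<dots> = 2 * real (card I) * (3 * x / real n)"
    by (simp add: Z_def card_cartesian_product x_def)
  also have "\<dots> \<le> 2 * (5 * x) * (3 * x / real n)"
    using cardI x by (intro mult_right_mono) auto
  finally have P2: "prob U2 \<le> 30 * x\<^sup>2 / real n" by (simp add: power2_eq_square)
  show ?thesis
  proof (rule that[of "G - (U1 \<union> U2)"])
    show "G - (U1 \<union> U2) \<in> events" using G U by auto
    have "prob (G \<inter> (U1 \<union> U2)) \<le> prob (U1 \<union> U2)" using U by (intro finite_measure_mono) auto
    also have "\<dots> \<le> prob U1 + prob U2" using U by (rule measure_Un_le)
    finally show "1 - (9 * (R / s)\<^sup>2 * exp (- (real n / (36 * (R / s)\<^sup>2))) + 30 * (R / s)\<^sup>2 / real n)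
        \<le> prob (G - (U1 \<union> U2))"
      using P1 P2 G U finite_measure_Diff'[of G "U1 \<union> U2"] by (auto simp: x_def[symmetric])
    show "G - (U1 \<union> U2) \<subseteq> {\<omega> \<in> space (config_measure R n). good_config n s R \<omega>}"
    proof
      fix \<omega> assume \<omega>: "\<omega> \<in> G - (U1 \<union> U2)"
      then have sp: "\<omega> \<in> space (config_measure R n)" and wf: "well_formed_sd n \<omega>"
        and disk: "\<forall>i<n. norm (loc \<omega> i) \<le> R" by (auto simp: G_def)
      have "\<forall>v. \<exists>i. norm (lattice_point s v) \<le> R \<longrightarrow>
          i < n \<and> dist (loc \<omega> i) (lattice_point s v) \<le> s / 3"
      proof
        fix v
        show "\<exists>i. norm (lattice_point s v) \<le> R \<longrightarrow> i < n \<and> dist (loc \<omega> i) (lattice_point s v) \<le> s / 3"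
        proof (cases "norm (lattice_point s v) \<le> R")
          case True
          then have "v \<in> V" by (rule inV)
          moreover have "\<omega> \<notin> E v" using \<omega> \<open>v \<in> V\<close> by (auto simp: U1_def)
          ultimately show ?thesis using E(3)[OF _ sp] by blast
        qed auto
      qed
      then have "\<exists>rel. relay_map n s R \<omega> rel" unfolding relay_map_def by (rule choice)
      moreover have "light \<omega> k (of_int p)" if "\<bar>of_int p\<bar> \<le> R / s + 1" for k and p :: int
        using \<omega> sp wf inI[OF that] F(3)[of "(k, p)" \<omega>] by (auto simp: U2_def Z_def)
      ultimately have "good_config n s R \<omega>"
        unfolding good_config_def light_def using wf disk by blast
      then show "\<omega> \<in> {\<omega> \<in> space (config_measure R n). good_config n s R \<omega>}" using sp by simp
    qed
  qed
qed

end

subsection \<open>The asymptotic theorem\<close>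

text \<open>A fallback: every well-formed configuration must receive a system, also the unlucky
  ones. Each source sends directly, in a slot of its own; nothing is claimed about success.\<close>

lemma direct_system:
  assumes "well_formed_sd n \<omega>"
  shows "is_system n \<omega> (\<lambda>i. [i, dest \<omega> i], \<lambda>i j. Suc i)"
  using assms by (auto simp: is_system_def valid_route_def nhops_def well_formed_sd_def)

text \<open>Both regimes are instances that differ in mesh \<open>s\<close>, power \<open>P\<close>
  and period bound \<open>b\<close>. The system is chosen before W, since 0 < period <= b n yields
  the throughput bound for every W at once.\<close>

lemma scheme_exists:
  fixes R s P :: "nat \<Rightarrow> real"
  assumes M: "0 < M" "separated_SINR \<alpha> \<beta> M" and No: "0 < No"
    and R: "\<And>n. R n = real n powr \<gamma>"
    and s: "\<forall>\<^sub>F n in sequentially. 1 \<le> s n \<and> s n \<le> R n"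
    and P: "\<forall>\<^sub>F n in sequentially. 2 * \<beta> * No * (4 * s n) powr \<alpha> \<le> P n"
    and b: "\<forall>\<^sub>F n in sequentially. 32 * (real M)\<^sup>2 * (real n * s n / R n) \<le> b n"
    and lim: "(\<lambda>n. 9 * (R n / s n)\<^sup>2 * exp (- (real n / (36 * (R n / s n)\<^sup>2))) + 30 * (R n / s n)\<^sup>2 / real n)
      \<longlonglongrightarrow> 0"
  shows "\<exists>S :: nat \<Rightarrow> config \<Rightarrow> system.
    (\<forall>n \<omega>. n \<ge> 2 \<and> well_formed_sd n \<omega> \<longrightarrow> is_system n \<omega> (S n \<omega>)) \<and>
    prob_to_one (sd_measure \<gamma>)
      (\<lambda>n. {\<omega> \<in> space (sd_measure \<gamma> n). SINR_successful \<alpha> \<beta> No (P n) n \<omega> (S n \<omega>)}) \<and>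
    (\<forall>W :: real. W > 0 \<longrightarrow> prob_to_one (sd_measure \<gamma>)
      (\<lambda>n. {\<omega> \<in> space (sd_measure \<gamma> n). throughput W n (S n \<omega>) \<ge> W / b n}))"
proof -
  define fail where "fail n = 9 * (R n / s n)\<^sup>2 * exp (- (real n / (36 * (R n / s n)\<^sup>2))) +
    30 * (R n / s n)\<^sup>2 / real n" for n
  define ok where "ok n \<longleftrightarrow> 2 \<le> n \<and> 1 \<le> s n \<and> s n \<le> R n \<and>
    2 * \<beta> * No * (4 * s n) powr \<alpha> \<le> P n \<and> 32 * (real M)\<^sup>2 * (real n * s n / R n) \<le> b n" for n
  have ev_ok: "\<forall>\<^sub>F n in sequentially. ok n"
    using s P b eventually_ge_at_top[of "2 :: nat"] by eventually_elim (simp add: ok_def)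
  define good where "good n \<omega> T \<longleftrightarrow> is_system n \<omega> T \<and> SINR_successful \<alpha> \<beta> No (P n) n \<omega> T \<and>
    0 < period n T \<and> real (period n T) \<le> b n" for n \<omega> T
  define S where "S n \<omega> = (if \<exists>T. good n \<omega> T then SOME T. good n \<omega> T
    else (\<lambda>i. [i, dest \<omega> i], \<lambda>i j. Suc i))" for n \<omega>
  have S: "good n \<omega> (S n \<omega>)" if "good n \<omega> T" for n \<omega> T
  proof -
    have ex: "\<exists>T. good n \<omega> T" using that by blast
    then have "S n \<omega> = (SOME T. good n \<omega> T)" by (simp only: S_def if_True)
    then show ?thesis using someI_ex[OF ex] by simp
  qed
  have system: "is_system n \<omega> (S n \<omega>)" if "well_formed_sd n \<omega>" for n \<omega>
  proof (cases "\<exists>T. good n \<omega> T")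
    case True
    then show ?thesis using S by (auto simp: good_def)
  next
    case False
    then show ?thesis using direct_system[OF that] by (simp add: S_def)
  qed
  \<comment> \<open>For the n at which the asymptotic hypotheses do not yet hold, the empty event
    serves; it does not affect the limit.\<close>
  have ex_event: "\<exists>A. A \<in> sets (sd_measure \<gamma> n) \<and> A \<subseteq> {\<omega> \<in> space (sd_measure \<gamma> n). good n \<omega> (S n \<omega>)} \<and>
      (ok n \<longrightarrow> 1 - fail n \<le> measure (sd_measure \<gamma> n) A \<and> measure (sd_measure \<gamma> n) A \<le> 1)" for n
  proof (cases "ok n")
    case True
    then have ok: "2 \<le> n" "1 \<le> s n" "s n \<le> R n" "2 * \<beta> * No * (4 * s n) powr \<alpha> \<le> P n"
      "32 * (real M)\<^sup>2 * (real n * s n / R n) \<le> b n" by (auto simp: ok_def)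
    have sd: "sd_measure \<gamma> n = config_measure (R n) n" by (simp add: sd_measure_eq R)
    interpret random_network "R n" n using ok by unfold_locales auto
    obtain A where A: "A \<in> events" "A \<subseteq> {\<omega> \<in> space (config_measure (R n) n). good_config n (s n) (R n) \<omega>}"
      "1 - fail n \<le> prob A"
      unfolding fail_def using ok by (auto intro: prob_good_config_ge[of "s n"])
    have "good n \<omega> (S n \<omega>)" if "\<omega> \<in> A" for \<omega>
    proof -
      have "good_config n (s n) (R n) \<omega>" using A(2) that by auto
      from good_system_exists[OF M this ok(1,2) No ok(4)]
      obtain T where "good n \<omega> T" using ok(5) unfolding good_def by (meson order_trans)
      then show ?thesis by (rule S)
    qed
    then show ?thesis unfolding sd using A by (intro exI[of _ A]) auto
  next
    case False
    then show ?thesis by (intro exI[of _ "{}"]) auto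
  qed
  have "\<exists>A. \<forall>n. A n \<in> sets (sd_measure \<gamma> n) \<and>
      A n \<subseteq> {\<omega> \<in> space (sd_measure \<gamma> n). good n \<omega> (S n \<omega>)} \<and>
      (ok n \<longrightarrow> 1 - fail n \<le> measure (sd_measure \<gamma> n) (A n) \<and> measure (sd_measure \<gamma> n) (A n) \<le> 1)"
    by (intro choice allI ex_event)
  then obtain A where A: "\<And>n. A n \<in> sets (sd_measure \<gamma> n)"
    "\<And>n. A n \<subseteq> {\<omega> \<in> space (sd_measure \<gamma> n). good n \<omega> (S n \<omega>)}"
    "\<And>n. ok n \<Longrightarrow> 1 - fail n \<le> measure (sd_measure \<gamma> n) (A n)"
    "\<And>n. ok n \<Longrightarrow> measure (sd_measure \<gamma> n) (A n) \<le> 1"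
    by blast
  have "(\<lambda>n. 1 - fail n) \<longlonglongrightarrow> 1 - 0"
    unfolding fail_def by (intro tendsto_diff tendsto_const lim)
  then have "(\<lambda>n. measure (sd_measure \<gamma> n) (A n)) \<longlonglongrightarrow> 1"
    by (intro tendsto_sandwich[OF eventually_mono[OF ev_ok A(3)] eventually_mono[OF ev_ok A(4)]]) auto
  \<comment> \<open>One sequence of events witnesses success and throughput together.\<close>
  then have to_one: "prob_to_one (sd_measure \<gamma>) E"
    if "\<And>n. {\<omega> \<in> space (sd_measure \<gamma> n). good n \<omega> (S n \<omega>)} \<subseteq> E n" for E
    unfolding prob_to_one_def using A(1,2) that by (intro exI[of _ A]) blast
  show ?thesis
  proof (intro exI[of _ S] conjI allI impI)
    show "prob_to_one (sd_measure \<gamma>)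
      (\<lambda>n. {\<omega> \<in> space (sd_measure \<gamma> n). SINR_successful \<alpha> \<beta> No (P n) n \<omega> (S n \<omega>)})"
      by (rule to_one) (auto simp: good_def)
    fix W :: real assume W: "0 < W"
    show "prob_to_one (sd_measure \<gamma>)
      (\<lambda>n. {\<omega> \<in> space (sd_measure \<gamma> n). throughput W n (S n \<omega>) \<ge> W / b n})"
      by (rule to_one) (use W in \<open>auto simp: good_def throughput_def intro!: divide_left_mono\<close>)
  qed (use system in auto)
qed

theorem theorem1:
  fixes \<alpha> \<beta> :: real
  assumes "\<alpha> > 2" and "\<beta> > 0"
  shows "\<exists>c cbar :: real. c > 0 \<and> cbar > 0 \<and>
    (\<forall>No :: real. No > 0 \<longrightarrow>
      (\<exists>P :: real. P > 0 \<and>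
         (\<forall>\<gamma> :: real. 0 \<le> \<gamma> \<and> \<gamma> < 1/2 \<longrightarrow>
           (\<exists>S :: nat \<Rightarrow> config \<Rightarrow> system.
              (\<forall>n \<omega>. n \<ge> 2 \<and> well_formed_sd n \<omega> \<longrightarrow> is_system n \<omega> (S n \<omega>)) \<and>
              prob_to_one (sd_measure \<gamma>)
                (\<lambda>n. {\<omega> \<in> space (sd_measure \<gamma> n). SINR_successful \<alpha> \<beta> No P n \<omega> (S n \<omega>)}) \<and>
              (\<forall>W :: real. W > 0 \<longrightarrow>
                 prob_to_one (sd_measure \<gamma>)
                   (\<lambda>n. {\<omega> \<in> space (sd_measure \<gamma> n).
                          throughput W n (S n \<omega>) \<ge> W / (c * real n powr (1 - \<gamma>))})))) \<and>
      (\<exists>P :: real \<Rightarrow> nat \<Rightarrow> real.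
         (\<forall>\<gamma> n. P \<gamma> n > 0) \<and>
         (\<forall>\<gamma>. strict_mono (P \<gamma>)) \<and>
         (\<forall>n. strict_mono (\<lambda>\<gamma>. P \<gamma> n)) \<and>
         (\<forall>\<gamma> :: real. \<gamma> \<ge> 1/2 \<longrightarrow>
           (\<exists>S :: nat \<Rightarrow> config \<Rightarrow> system.
              (\<forall>n \<omega>. n \<ge> 2 \<and> well_formed_sd n \<omega> \<longrightarrow> is_system n \<omega> (S n \<omega>)) \<and>
              prob_to_one (sd_measure \<gamma>)
                (\<lambda>n. {\<omega> \<in> space (sd_measure \<gamma> n).
                       SINR_successful \<alpha> \<beta> No (P \<gamma> n) n \<omega> (S n \<omega>)}) \<and>
              (\<forall>W :: real. W > 0 \<longrightarrow>
                 prob_to_one (sd_measure \<gamma>)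
                   (\<lambda>n. {\<omega> \<in> space (sd_measure \<gamma> n).
                          throughput W n (S n \<omega>) \<ge> W / (cbar * sqrt (real n * ln (real n)))})))))))"
proof -
  obtain M :: nat where M: "0 < M" "separated_SINR \<alpha> \<beta> M"
    using separated_SINR_exists[OF assms] .
  \<comment> \<open>Here n s / R equals n^(1 - gamma) for mesh 1 and 6 sqrt (n ln n) for the growing
    mesh; thus 192 = 6 * 32.\<close>
  define c cbar where "c = 32 * (real M)\<^sup>2" and "cbar = 192 * (real M)\<^sup>2"
  have ev_pos: "\<forall>\<^sub>F n in sequentially. 0 < real n"
    using eventually_gt_at_top[of "0 :: nat"] by eventually_elim simp
  show ?thesis (is "\<exists>c cbar. _ \<and> _ \<and> (\<forall>No. _ \<longrightarrow> (\<exists>P. _ \<and> ?low c No P \<and> ?high cbar No))")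
  proof (rule exI[of _ c], rule exI[of _ cbar], intro conjI allI impI)
    show "0 < c" "0 < cbar" using M by (simp_all add: c_def cbar_def)
    fix No :: real assume No: "0 < No"
    \<comment> \<open>The power threshold at s = 1; for general s it is \<open>D\<close> times
      s^alpha.\<close>
    define D where "D = 2 * \<beta> * No * 4 powr \<alpha>"
    have D: "0 < D" using No assms by (simp add: D_def)
    have low: "?low c No D"
    proof (intro allI impI)
      fix \<gamma> :: real assume \<gamma>: "0 \<le> \<gamma> \<and> \<gamma> < 1 / 2"
      \<comment> \<open>Up to a constant, n^a is the expected number of nodes in a unit cell; a > 0
        is exactly gamma < 1/2. Both error terms are then governed by R^2 = n^(1 - a).\<close>
      define a where "a = 1 - 2 * \<gamma>"
      have a: "0 < a" "a \<le> 1" using \<gamma> by (auto simp: a_def)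
      have "(\<lambda>n. 9 * real n powr (1 - a) * exp (- (real n powr a / 36)) + 30 * real n powr - a) \<longlonglongrightarrow> 0"
        using a by real_asymp
      moreover have "\<forall>\<^sub>F n in sequentially. 9 * real n powr (1 - a) * exp (- (real n powr a / 36)) + 30 * real n powr - a
          = 9 * (real n powr \<gamma> / 1)\<^sup>2 * exp (- (real n / (36 * (real n powr \<gamma> / 1)\<^sup>2)))
            + 30 * (real n powr \<gamma> / 1)\<^sup>2 / real n"
        using ev_pos
      proof eventually_elim
        case (elim n)
        have sq: "(real n powr \<gamma> / 1)\<^sup>2 = real n powr (1 - a)"
          using elim by (simp add: a_def power2_eq_square flip: powr_add)
        have "real n / real n powr (1 - a) = real n powr a" "real n powr (1 - a) / real n = real n powr - a"
          using elim powr_diff[of "real n" 1 "1 - a"] powr_diff[of "real n" "1 - a" 1] by simp_all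
        then have "real n / (36 * real n powr (1 - a)) = real n powr a / 36"
          "30 * real n powr (1 - a) / real n = 30 * real n powr - a"
          by (metis divide_divide_eq_left mult.commute, metis times_divide_eq_right)
        then show ?case unfolding sq by simp
      qed
      ultimately have lim: "(\<lambda>n. 9 * (real n powr \<gamma> / 1)\<^sup>2 * exp (- (real n / (36 * (real n powr \<gamma> / 1)\<^sup>2)))
            + 30 * (real n powr \<gamma> / 1)\<^sup>2 / real n) \<longlonglongrightarrow> 0"
        by (rule Lim_transform_eventually)
      show "\<exists>S :: nat \<Rightarrow> config \<Rightarrow> system.
              (\<forall>n \<omega>. n \<ge> 2 \<and> well_formed_sd n \<omega> \<longrightarrow> is_system n \<omega> (S n \<omega>)) \<and>
              prob_to_one (sd_measure \<gamma>)
                (\<lambda>n. {\<omega> \<in> space (sd_measure \<gamma> n). SINR_successful \<alpha> \<beta> No D n \<omega> (S n \<omega>)}) \<and>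
              (\<forall>W :: real. W > 0 \<longrightarrow>
                 prob_to_one (sd_measure \<gamma>)
                   (\<lambda>n. {\<omega> \<in> space (sd_measure \<gamma> n).
                          throughput W n (S n \<omega>) \<ge> W / (c * real n powr (1 - \<gamma>))}))"
      proof (rule scheme_exists[OF M No refl _ _ _ lim])
        show "\<forall>\<^sub>F n in sequentially. 1 \<le> (1 :: real) \<and> 1 \<le> real n powr \<gamma>"
          using eventually_ge_at_top[of "1 :: nat"] by eventually_elim (use \<gamma> in \<open>auto intro: ge_one_powr_ge_zero\<close>)
        show "\<forall>\<^sub>F n in sequentially. 2 * \<beta> * No * (4 * 1) powr \<alpha> \<le> D" by (simp add: D_def)
        show "\<forall>\<^sub>F n in sequentially. 32 * (real M)\<^sup>2 * (real n * 1 / real n powr \<gamma>) \<le> c * real n powr (1 - \<gamma>)"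
          using ev_pos by eventually_elim (simp add: c_def powr_diff)
      qed
    qed
    \<comment> \<open>The exponent exp gamma instead of gamma gives strict monotonicity also for gamma <= 0.\<close>
    define P :: "real \<Rightarrow> nat \<Rightarrow> real" where "P \<gamma> n = D * (real n + 2) powr (\<alpha> * exp \<gamma>)" for \<gamma> n
    have high: "?high cbar No"
    proof (intro exI[of _ P] conjI allI impI)
      show "0 < P \<gamma> n" for \<gamma> n using D by (simp add: P_def)
      \<comment> \<open>The shift to n + 2 keeps the base above 1 even for n = 0, as strict growth
        in gamma requires for every n.\<close>
      show "strict_mono (P \<gamma>)" for \<gamma>
        using D assms by (auto simp: strict_mono_def P_def intro!: powr_less_mono2)
      show "strict_mono (\<lambda>\<gamma>. P \<gamma> n)" for n
        using D assms by (auto simp: strict_mono_def P_def intro!: powr_less_mono)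
      fix \<gamma> :: real assume \<gamma>: "1 / 2 \<le> \<gamma>"
      \<comment> \<open>The 6 cancels the 36 of the relay estimate: n / (36 (R/s)^2) = ln n, so a
        given lattice point fails with probability at most 1/n, against 9 n / (36 ln n) lattice
        points.\<close>
      define s where "s n = 6 * real n powr \<gamma> * sqrt (ln (real n) / real n)" for n
      have large: "\<forall>\<^sub>F n in sequentially. 1 \<le> ln (real n) \<and> 0 < real n \<and> 36 * ln (real n) / real n \<le> 1"
        by (intro eventually_conj; real_asymp)
      have s_bounds: "\<forall>\<^sub>F n in sequentially. 1 \<le> s n \<and> s n \<le> real n powr \<gamma>"
        using large
      proof eventually_elim
        case (elim n)
        have n1: "1 \<le> real n" using elim by (cases n) auto
        \<comment> \<open>Here gamma >= 1/2 enters: R >= sqrt n gives s >= 6 sqrt (ln n), which is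
          eventually at least 1.\<close>
        have "sqrt (real n) \<le> real n powr \<gamma>"
          using n1 \<gamma> by (simp add: powr_half_sqrt[symmetric] powr_mono)
        then have "6 * sqrt (real n) * sqrt (ln (real n) / real n) \<le> s n"
          unfolding s_def using elim by (intro mult_right_mono) auto
        also have "6 * sqrt (real n) * sqrt (ln (real n) / real n) = 6 * sqrt (ln (real n))"
          using elim by (simp add: real_sqrt_divide)
        finally have "6 * sqrt (ln (real n)) \<le> s n" .
        moreover have "1 \<le> sqrt (ln (real n))" using elim by simp
        ultimately have "1 \<le> s n" by linarith
        have "6 * sqrt (ln (real n) / real n) = sqrt (36 * ln (real n) / real n)"
          using real_sqrt_mult[of 36 "ln (real n) / real n"] by simp
        also have "\<dots> \<le> 1" using elim by simp
        finally have "real n powr \<gamma> * (6 * sqrt (ln (real n) / real n)) \<le> real n powr \<gamma> * 1"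
          by (intro mult_left_mono) auto
        then show ?case using \<open>1 \<le> s n\<close> by (simp add: s_def mult_ac)
      qed
      have ratio: "\<forall>\<^sub>F n in sequentially. (real n powr \<gamma> / s n)\<^sup>2 = real n / (36 * ln (real n)) \<and>
          real n * s n / real n powr \<gamma> = 6 * sqrt (real n * ln (real n))"
        using large
      proof eventually_elim
        case (elim n)
        have "real n powr \<gamma> / s n = 1 / (6 * sqrt (ln (real n) / real n))"
          using elim by (simp add: s_def)
        then have "(real n powr \<gamma> / s n)\<^sup>2 = real n / (36 * ln (real n))"
          using elim by (simp add: power_divide power_mult_distrib)
        moreover have "real n * s n / real n powr \<gamma> = 6 * (real n * sqrt (ln (real n) / real n))"
          using elim by (simp add: s_def)
        moreover have "real n * sqrt (ln (real n) / real n) = sqrt (real n * ln (real n))"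
          using elim by (simp add: real_sqrt_divide real_sqrt_mult field_simps)
        ultimately show ?case by simp
      qed
      have "(\<lambda>n. 9 * (real n / (36 * ln (real n))) * exp (- ln (real n)) + 30 / (36 * ln (real n))) \<longlonglongrightarrow> 0"
        by real_asymp
      moreover have "\<forall>\<^sub>F n in sequentially.
          9 * (real n / (36 * ln (real n))) * exp (- ln (real n)) + 30 / (36 * ln (real n))
          = 9 * (real n powr \<gamma> / s n)\<^sup>2 * exp (- (real n / (36 * (real n powr \<gamma> / s n)\<^sup>2)))
            + 30 * (real n powr \<gamma> / s n)\<^sup>2 / real n"
        using large ratio
      proof eventually_elim
        case (elim n)
        then have "real n / (36 * (real n / (36 * ln (real n)))) = ln (real n)" by simp
        then show ?case using elim by simp
      qed
      ultimately have lim: "(\<lambda>n. 9 * (real n powr \<gamma> / s n)\<^sup>2 * exp (- (real n / (36 * (real n powr \<gamma> / s n)\<^sup>2)))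
            + 30 * (real n powr \<gamma> / s n)\<^sup>2 / real n) \<longlonglongrightarrow> 0"
        by (rule Lim_transform_eventually)
      show "\<exists>S :: nat \<Rightarrow> config \<Rightarrow> system.
              (\<forall>n \<omega>. n \<ge> 2 \<and> well_formed_sd n \<omega> \<longrightarrow> is_system n \<omega> (S n \<omega>)) \<and>
              prob_to_one (sd_measure \<gamma>)
                (\<lambda>n. {\<omega> \<in> space (sd_measure \<gamma> n).
                       SINR_successful \<alpha> \<beta> No (P \<gamma> n) n \<omega> (S n \<omega>)}) \<and>
              (\<forall>W :: real. W > 0 \<longrightarrow>
                 prob_to_one (sd_measure \<gamma>)
                   (\<lambda>n. {\<omega> \<in> space (sd_measure \<gamma> n).
                          throughput W n (S n \<omega>) \<ge> W / (cbar * sqrt (real n * ln (real n)))}))"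
      proof (rule scheme_exists[OF M No refl s_bounds _ _ lim])
        show "\<forall>\<^sub>F n in sequentially. 2 * \<beta> * No * (4 * s n) powr \<alpha> \<le> P \<gamma> n"
          using s_bounds
        proof eventually_elim
          case (elim n)
          have "s n \<le> (real n + 2) powr exp \<gamma>"
          proof -
            have "\<gamma> \<le> exp \<gamma>" using exp_ge_add_one_self[of \<gamma>] by linarith
            then have "(real n + 2) powr \<gamma> \<le> (real n + 2) powr exp \<gamma>" by (intro powr_mono) auto
            moreover have "real n powr \<gamma> \<le> (real n + 2) powr \<gamma>" using \<gamma> by (intro powr_mono2) auto
            ultimately show ?thesis using elim by linarith
          qed
          then have "s n powr \<alpha> \<le> ((real n + 2) powr exp \<gamma>) powr \<alpha>"
            using elim assms by (intro powr_mono2) auto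
          also have "\<dots> = (real n + 2) powr (\<alpha> * exp \<gamma>)" by (simp add: powr_powr mult.commute)
          finally have "D * s n powr \<alpha> \<le> P \<gamma> n" using D by (simp add: P_def)
          then show ?case by (simp add: D_def powr_mult mult.assoc)
        qed
        show "\<forall>\<^sub>F n in sequentially. 32 * (real M)\<^sup>2 * (real n * s n / real n powr \<gamma>) \<le> cbar * sqrt (real n * ln (real n))"
          using ratio by eventually_elim (simp add: cbar_def)
      qed
    qed
    show "\<exists>P. 0 < P \<and> ?low c No P \<and> ?high cbar No"
      by (rule exI[of _ D], intro conjI D low high)
  qed
qed

end
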